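(* Let $B\subseteq\mathcal B(H)$ with $H$ finite-dimensional, and let $q\in\mathcal B(H)$ be positive and invertible and implement $(\sigma_t)$, i.e. $\sigma_t(a)=q^{it}aq^{-it}$ for $a\in B$, $t\in\mathbb R$. Given a subspace $S\subseteq\mathcal B(H)$ let $S_0=q^{1/2}S$, so that $S=q^{-1/2}S_0$ and $S\mapsto S_0$ is a bijection on subspaces of $\mathcal B(H)$. Then $S$ is a self-adjoint $B'$-bimodule with $qSq^{-1}=S$ if and only if $S_0$ is a self-adjoint $B'$-bimodule with $qS_0q^{-1}=S_0$. Furthermore, $q^{-1/2}\in S$ if and only if $1\in S_0$. Thus if $S$ is associated to a quantum adjacency matrix, then $S_0$ is a self-adjoint $B'$-bimodule containing $1$ with the additional property that $qS_0q^{-1}=S_0$; and conversely, if $S_0$ is a self-adjoint $B'$-bimodule containing $1$ with $qS_0q^{-1}=S_0$, then $S$ is associated to a quantum adjacency matrix.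
   Context: $B$ is a finite-dimensional $C^*$-algebra, $\mathrm{Tr}$ the sum of the non-normalised traces of its matrix blocks, $\psi$ a faithful state on $B$, $Q\in B$ the positive invertible element with $\psi(a)=\mathrm{Tr}(Qa)$, and $\sigma_z(a)=Q^{iz}aQ^{-iz}$ for $z\in\mathbb C$, $a\in B$. Inner products are linear in the right variable and $\theta_{\xi,\eta}(\zeta)=(\xi|\zeta)\eta$. $L^2(B)$ is the GNS space of $\psi$ with GNS map $\Lambda$ (a linear bijection), $(\Lambda(a)|\Lambda(b))=\psi(a^*b)$; $m(\Lambda(a)\otimes\Lambda(b))=\Lambda(ab)$ with Hilbert space adjoint $m^*$; $\eta:\mathbb C\to L^2(B)$, $\lambda\mapsto\lambda\Lambda(1)$, with adjoint $\eta^*$. A quantum adjacency matrix is a self-adjoint $A\in\mathcal B(L^2(B))$ with $m(A\otimes A)m^*=A$, $(1\otimes\eta^*m)(1\otimes A\otimes1)(m^*\eta\otimes1)=A$, and $m(A\otimes1)m^*=1$. $B$ is a unital $*$-subalgebra of $\mathcal B(H)$ with commutant $B'$. A $B'$-bimodule is a subspace $S\subseteq\mathcal B(H)$ with $xsy\in S$ for $x,y\in B'$, $s\in S$; self-adjoint means $S^*=S$. $B^{\mathrm{op}}$ is $B$ with reversed product; $\overline H$ is the conjugate Hilbert space; $x^\top(\overline\xi)=\overline{x^*\xi}$; $B\otimes B^{\mathrm{op}}$ acts on $H\otimes\overline H$ via $a\otimes b\mapsto a\otimes b^\top$; and $\mathcal B(H)\cong H\otimes\overline H$ via $\theta_{\xi,\eta}\mapsto\eta\otimes\overline\xi$.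 The subspace $S\subseteq\mathcal B(H)$ associated to $A$ is the one corresponding to the image in $H\otimes\overline H$ of $e=\Psi_{0,1/2}(A)\in B\otimes B^{\mathrm{op}}$, where $\Psi_{0,1/2}$ is the linear map with $\theta_{\Lambda(a),\Lambda(b)}\mapsto a^*\otimes\sigma_{i/2}(b)$ (for such $A$, $e$ is an orthogonal projection). *)

theory Defs
  imports "HOL-Analysis.Analysis"
begin

text \<open>
  The finite-dimensional Hilbert space \<open>H\<close> is \<open>complex^'n\<close>, and \<open>\<B>(H)\<close> is \<open>complex^'n^'n\<close>.
  \<open>L\<^sup>2(B)\<close> is \<open>complex^'m\<close>. Tensor products of such spaces are indexed by product types.
  The operations \<open>*s\<close> and \<open>\<bullet>\<close> of the library do not provide complex scalar multiplication on
  matrices or the complex inner product, so these are introduced first.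
\<close>

section \<open>Complex matrices\<close>

definition cscale :: "complex \<Rightarrow> complex^'n^'m \<Rightarrow> complex^'n^'m" where
  "cscale c X = (\<chi> i j. c * X $ i $ j)"

interpretation cmat: vector_space "cscale :: complex \<Rightarrow> complex^'n^'m \<Rightarrow> complex^'n^'m"
  by standard (simp_all add: cscale_def vec_eq_iff algebra_simps)

definition cinner :: "complex^'n \<Rightarrow> complex^'n \<Rightarrow> complex" where
  "cinner \<xi> \<eta> = (\<Sum>i\<in>UNIV. cnj (\<xi> $ i) * \<eta> $ i)"

definition cadj :: "complex^'n^'m \<Rightarrow> complex^'m^'n" where
  "cadj X = (\<chi> i j. cnj (X $ j $ i))"

lemma cinner_cadj: "cinner (cadj X *v \<xi>) \<eta> = cinner \<xi> (X *v \<eta>)"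
proof -
  have "cinner (cadj X *v \<xi>) \<eta> = (\<Sum>i\<in>UNIV. \<Sum>j\<in>UNIV. X $ j $ i * cnj (\<xi> $ j) * \<eta> $ i)"
    by (simp add: cinner_def cadj_def matrix_vector_mult_def sum_distrib_right)
  also have "\<dots> = (\<Sum>j\<in>UNIV. \<Sum>i\<in>UNIV. X $ j $ i * cnj (\<xi> $ j) * \<eta> $ i)"
    by (rule sum.swap)
  also have "\<dots> = cinner \<xi> (X *v \<eta>)"
    by (simp add: cinner_def matrix_vector_mult_def sum_distrib_left mult_ac)
  finally show ?thesis .
qed

text \<open>Over the complex numbers this condition includes self-adjointness.\<close>

definition positive_op :: "complex^'n^'n \<Rightarrow> bool" where
  "positive_op X \<longleftrightarrow> (\<forall>v. cinner v (X *v v) \<in> \<real>\<^sub>\<ge>\<^sub>0)"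

text \<open>
  Functional calculus: for \<open>X\<close> positive and invertible, \<open>X\<^sup>w\<close> is the operator acting as
  multiplication by \<open>\<lambda>\<^sup>w\<close> on the \<open>\<lambda>\<close>-eigenspace of \<open>X\<close>, for each eigenvalue \<open>\<lambda>\<close> (which is \<open>> 0\<close>).
  Existence and uniqueness are the spectral theorem.
\<close>

definition mpow :: "complex^'n^'n \<Rightarrow> complex \<Rightarrow> complex^'n^'n" where
  "mpow X w = (THE P. \<forall>(l::real) v.
     X *v v = complex_of_real l *s v \<longrightarrow> P *v v = (complex_of_real l powr w) *s v)"

definition vtensor :: "complex^'a \<Rightarrow> complex^'b \<Rightarrow> complex^('a \<times> 'b)" where
  "vtensor \<xi> \<eta> = (\<chi> p. \<xi> $ fst p * \<eta> $ snd p)"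

definition kron :: "complex^'a^'c \<Rightarrow> complex^'b^'d \<Rightarrow> complex^('a \<times> 'b)^('c \<times> 'd)" where
  "kron X Y = (\<chi> p q. X $ fst p $ fst q * Y $ snd p $ snd q)"

lemma kron_vtensor: "kron X Y *v vtensor \<xi> \<eta> = vtensor (X *v \<xi>) (Y *v \<eta>)"
  by (simp add: kron_def vtensor_def matrix_vector_mult_def vec_eq_iff sum_product
      sum.cartesian_product UNIV_Times_UNIV[symmetric] split_beta mult_ac del: UNIV_Times_UNIV)

text \<open>\<open>\<theta>\<^bsub>\<xi>,\<eta>\<^esub>(\<zeta>) = (\<xi>|\<zeta>) \<eta>\<close>\<close>

definition theta :: "complex^'n \<Rightarrow> complex^'m \<Rightarrow> complex^'n^'m" where
  "theta \<xi> \<eta> = (\<chi> i j. \<eta> $ i * cnj (\<xi> $ j))"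

lemma theta_apply: "theta \<xi> \<eta> *v \<zeta> = cinner \<xi> \<zeta> *s \<eta>"
  by (simp add: theta_def cinner_def matrix_vector_mult_def vec_eq_iff sum_distrib_right
      sum_distrib_left mult_ac)

text \<open>
  The canonical identifications \<open>(X \<otimes> Y) \<otimes> Z \<cong> X \<otimes> (Y \<otimes> Z)\<close>, \<open>X \<cong> \<complex> \<otimes> X\<close> and \<open>X \<otimes> \<complex> \<cong> X\<close>,
  where \<open>\<complex>\<close> is \<open>complex^1\<close>.
\<close>

definition assoc_op :: "complex^(('a::finite \<times> 'b::finite) \<times> 'c::finite)^('a \<times> ('b \<times> 'c))" where
  "assoc_op = (\<chi> p q. if p = (fst (fst q), (snd (fst q), snd q)) then 1 else 0)"

definition lunit_op :: "complex^'a^(1 \<times> 'a)" where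
  "lunit_op = (\<chi> p i. if snd p = i then 1 else 0)"

definition runit_op :: "complex^('a \<times> 1)^'a" where
  "runit_op = (\<chi> i p. if fst p = i then 1 else 0)"

lemma assoc_op_vtensor:
  "assoc_op *v vtensor (vtensor \<xi> \<eta>) \<zeta> = vtensor \<xi> (vtensor \<eta> \<zeta>)"
proof -
  have eq: "(p = (fst (fst q), snd (fst q), snd q)) = (q = ((fst p, fst (snd p)), snd (snd p)))"
    for p :: "'a \<times> 'b \<times> 'c" and q by (metis fst_conv prod.collapse snd_conv)
  show ?thesis
    by (simp add: assoc_op_def vtensor_def matrix_vector_mult_def vec_eq_iff eq if_distrib
        if_distribR cong: if_cong)
qed

lemma lunit_op_apply: "lunit_op *v \<xi> = vtensor (vec 1) \<xi>"
  by (simp add: lunit_op_def vtensor_def matrix_vector_mult_def vec_eq_iff if_distrib if_distribR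
      cong: if_cong)

lemma runit_op_vtensor: "runit_op *v vtensor \<xi> c = (c $ 1) *s \<xi>"
proof -
  have eq: "(fst p = i) = (p = (i, 1))" for p :: "'a \<times> 1" and i
    by (metis fst_conv num1_eq_iff prod.collapse)
  show ?thesis
    by (simp add: runit_op_def vtensor_def matrix_vector_mult_def vec_eq_iff eq if_distrib
        if_distribR mult_ac cong: if_cong)
qed

section \<open>The algebra, the trace and the state\<close>

definition unital_star_subalgebra :: "(complex^'n^'n) set \<Rightarrow> bool" where
  "unital_star_subalgebra B \<longleftrightarrow>
     cmat.subspace B \<and> mat 1 \<in> B \<and> (\<forall>a\<in>B. \<forall>b\<in>B. a ** b \<in> B) \<and> (\<forall>a\<in>B. cadj a \<in> B)"

definition commutant :: "(complex^'n^'n) set \<Rightarrow> (complex^'n^'n) set" where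
  "commutant B = {x. \<forall>a\<in>B. x ** a = a ** x}"

text \<open>
  The direct sum of full matrix algebras, one for each value of the labelling \<open>blk\<close>, as an
  algebra of block-diagonal matrices. The sum of the traces of the blocks is the library's
  \<open>trace\<close> of the block-diagonal matrix.
\<close>

definition block_diag :: "('d \<Rightarrow> nat) \<Rightarrow> (complex^'d^'d) set" where
  "block_diag blk = {X. \<forall>i j. blk i \<noteq> blk j \<longrightarrow> X $ i $ j = 0}"

text \<open>
  \<open>\<phi>\<close> is a \<open>*\<close>-isomorphism of \<open>B\<close> onto such a direct sum. The functional \<open>\<lambda>a. trace (\<phi> a)\<close>
  on \<open>B\<close> is then \<open>Tr\<close>. In general it differs from the trace of \<open>a\<close> as an operator on \<open>H\<close>, as
  the blocks may occur in \<open>H\<close> with multiplicities.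
\<close>

definition block_decomposition ::
  "(complex^'n^'n) set \<Rightarrow> ('d \<Rightarrow> nat) \<Rightarrow> (complex^'n^'n \<Rightarrow> complex^'d^'d) \<Rightarrow> bool" where
  "block_decomposition B blk \<phi> \<longleftrightarrow>
     bij_betw \<phi> B (block_diag blk) \<and>
     (\<forall>a\<in>B. \<forall>b\<in>B. \<phi> (a + b) = \<phi> a + \<phi> b \<and> \<phi> (a ** b) = \<phi> a ** \<phi> b) \<and>
     (\<forall>c. \<forall>a\<in>B. \<phi> (cscale c a) = cscale c (\<phi> a)) \<and>
     (\<forall>a\<in>B. \<phi> (cadj a) = cadj (\<phi> a))"

definition faithful_state :: "(complex^'n^'n) set \<Rightarrow> (complex^'n^'n \<Rightarrow> complex) \<Rightarrow> bool" where
  "faithful_state B \<psi> \<longleftrightarrow>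
     (\<forall>a\<in>B. \<forall>b\<in>B. \<psi> (a + b) = \<psi> a + \<psi> b) \<and>
     (\<forall>c. \<forall>a\<in>B. \<psi> (cscale c a) = c * \<psi> a) \<and>
     (\<forall>a\<in>B. \<psi> (cadj a ** a) \<in> \<real>\<^sub>\<ge>\<^sub>0) \<and>
     \<psi> (mat 1) = 1 \<and>
     (\<forall>a\<in>B. \<psi> (cadj a ** a) = 0 \<longrightarrow> a = 0)"

text \<open>\<open>\<sigma>\<^sub>z(a) = Q\<^sup>i\<^sup>z a Q\<^sup>-\<^sup>i\<^sup>z\<close>\<close>

definition modular :: "complex^'n^'n \<Rightarrow> complex \<Rightarrow> complex^'n^'n \<Rightarrow> complex^'n^'n" where
  "modular Q z a = mpow Q (\<i> * z) ** a ** mpow Q (- (\<i> * z))"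

section \<open>The GNS space and quantum adjacency matrices\<close>

definition gns_map ::
  "(complex^'n^'n) set \<Rightarrow> (complex^'n^'n \<Rightarrow> complex) \<Rightarrow> (complex^'n^'n \<Rightarrow> complex^'m) \<Rightarrow> bool" where
  "gns_map B \<psi> \<Lambda> \<longleftrightarrow>
     bij_betw \<Lambda> B UNIV \<and>
     (\<forall>a\<in>B. \<forall>b\<in>B. \<Lambda> (a + b) = \<Lambda> a + \<Lambda> b) \<and>
     (\<forall>c. \<forall>a\<in>B. \<Lambda> (cscale c a) = c *s \<Lambda> a) \<and>
     (\<forall>a\<in>B. \<forall>b\<in>B. cinner (\<Lambda> a) (\<Lambda> b) = \<psi> (cadj a ** b))"

text \<open>The element of \<open>B\<close> which \<open>\<Lambda>\<close> sends to the \<open>i\<close>-th standard basis vector.\<close>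

definition gns_basis ::
  "(complex^'n^'n) set \<Rightarrow> (complex^'n^'n \<Rightarrow> complex^'m) \<Rightarrow> 'm \<Rightarrow> complex^'n^'n" where
  "gns_basis B \<Lambda> i = inv_into B \<Lambda> (axis i 1)"

text \<open>
  \<open>m\<close>, defined on the standard basis. The characterising property
  \<open>m (\<Lambda> a \<otimes> \<Lambda> b) = \<Lambda> (a b)\<close> is \<open>gns_mult_vtensor\<close> below.
\<close>

definition gns_mult ::
  "(complex^'n^'n) set \<Rightarrow> (complex^'n^'n \<Rightarrow> complex^'m) \<Rightarrow> complex^('m \<times> 'm)^'m" where
  "gns_mult B \<Lambda> = (\<chi> i p. \<Lambda> (gns_basis B \<Lambda> (fst p) ** gns_basis B \<Lambda> (snd p)) $ i)"

definition gns_unit :: "(complex^'n^'n \<Rightarrow> complex^'m) \<Rightarrow> complex^1^'m" where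
  "gns_unit \<Lambda> = (\<chi> i j. \<Lambda> (mat 1) $ i)"

definition quantum_adjacency ::
  "(complex^'n^'n) set \<Rightarrow> (complex^'n^'n \<Rightarrow> complex^'m) \<Rightarrow> complex^'m^'m \<Rightarrow> bool" where
  "quantum_adjacency B \<Lambda> A \<longleftrightarrow>
     (let m = gns_mult B \<Lambda>; \<eta> = gns_unit \<Lambda>; I = mat 1 in
        cadj A = A \<and>
        m ** kron A A ** cadj m = A \<and>
        runit_op ** kron I (cadj \<eta> ** m) ** kron I (kron A I) ** assoc_op
          ** kron (cadj m ** \<eta>) I ** lunit_op = A \<and>
        m ** kron A I ** cadj m = I)"

section \<open>Operator bimodules\<close>

definition bimodule :: "(complex^'n^'n) set \<Rightarrow> (complex^'n^'n) set \<Rightarrow> bool" where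
  "bimodule C S \<longleftrightarrow> cmat.subspace S \<and> (\<forall>x\<in>C. \<forall>y\<in>C. \<forall>s\<in>S. x ** s ** y \<in> S)"

definition self_adjoint_bimodule :: "(complex^'n^'n) set \<Rightarrow> (complex^'n^'n) set \<Rightarrow> bool" where
  "self_adjoint_bimodule C S \<longleftrightarrow> bimodule C S \<and> cadj ` S = S"

text \<open>
  \<open>\<Psi>\<^bsub>0,1/2\<^esub>\<close>. The vector space underlying \<open>B \<otimes> B\<^sup>o\<^sup>p\<close> is the span of the Kronecker products
  \<open>kron a b\<close> with \<open>a, b \<in> B\<close>. As \<open>\<theta>\<close> of the basis vectors \<open>j\<close>, \<open>i\<close> is the matrix unit
  \<open>(i, j)\<close>, this is the linear extension of the defining formula. The formula itself is
  \<open>Psi_theta\<close> below.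
\<close>

definition Psi ::
  "(complex^'n^'n) set \<Rightarrow> (complex^'n^'n \<Rightarrow> complex^'m) \<Rightarrow> complex^'n^'n \<Rightarrow> complex^'m^'m \<Rightarrow>
   complex^('n \<times> 'n)^('n \<times> 'n)" where
  "Psi B \<Lambda> Q A = (\<Sum>i\<in>UNIV. \<Sum>j\<in>UNIV. cscale (A $ i $ j)
     (kron (cadj (gns_basis B \<Lambda> j)) (modular Q (\<i> / 2) (gns_basis B \<Lambda> i))))"

text \<open>
  The conjugate Hilbert space of \<open>H\<close> is \<open>complex^'n\<close>, with \<open>\<xi>\<close> conjugated corresponding to
  \<open>cbar \<xi>\<close>. Then \<open>x\<^sup>\<top>\<close> is the transposed matrix, and the action \<open>a \<otimes> b \<mapsto> a \<otimes> b\<^sup>\<top>\<close>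
  is the partial transpose in the second factor.
\<close>

definition cbar :: "complex^'n \<Rightarrow> complex^'n" where
  "cbar \<xi> = (\<chi> i. cnj (\<xi> $ i))"

lemma transpose_cbar: "transpose x *v cbar \<xi> = cbar (cadj x *v \<xi>)"
  by (simp add: transpose_def cbar_def cadj_def matrix_vector_mult_def vec_eq_iff)

definition op_action :: "complex^('n::finite \<times> 'n)^('n \<times> 'n) \<Rightarrow> complex^('n \<times> 'n)^('n \<times> 'n)" where
  "op_action e = (\<chi> p q. e $ (fst p, snd q) $ (fst q, snd p))"

lemma op_action_kron: "op_action (kron a b) = kron a (transpose b)"
  by (simp add: op_action_def kron_def transpose_def vec_eq_iff)

lemma op_action_add: "op_action (e + f) = op_action e + op_action f"
  and op_action_cscale: "op_action (cscale c e) = cscale c (op_action e)"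
  by (simp_all add: op_action_def cscale_def vec_eq_iff)

text \<open>The identification of \<open>\<B>(H)\<close> with \<open>H\<close> tensored with its conjugate, \<open>\<theta>\<^bsub>\<xi>,\<eta>\<^esub> \<mapsto> \<eta> \<otimes> \<xi>\<close> conjugated.\<close>

definition opvec :: "complex^'n^'n \<Rightarrow> complex^('n \<times> 'n)" where
  "opvec T = (\<chi> p. T $ fst p $ snd p)"

lemma opvec_theta: "opvec (theta \<xi> \<eta>) = vtensor \<eta> (cbar \<xi>)"
  by (simp add: opvec_def theta_def vtensor_def cbar_def vec_eq_iff)

definition associated_subspace ::
  "(complex^'n^'n) set \<Rightarrow> (complex^'n^'n \<Rightarrow> complex^'m) \<Rightarrow> complex^'n^'n \<Rightarrow> complex^'m^'m \<Rightarrow>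
   (complex^'n^'n) set" where
  "associated_subspace B \<Lambda> Q A = {T. opvec T \<in> range (\<lambda>v. op_action (Psi B \<Lambda> Q A) *v v)}"

definition associated_to_quantum_adjacency ::
  "(complex^'n^'n) set \<Rightarrow> (complex^'n^'n \<Rightarrow> complex^'m) \<Rightarrow> complex^'n^'n \<Rightarrow>
   (complex^'n^'n) set \<Rightarrow> bool" where
  "associated_to_quantum_adjacency B \<Lambda> Q S \<longleftrightarrow>
     (\<exists>A. quantum_adjacency B \<Lambda> A \<and> S = associated_subspace B \<Lambda> Q A)"

section \<open>The characterising properties of \<open>m\<close> and \<open>\<Psi>\<^bsub>0,1/2\<^esub>\<close>\<close>

context
  fixes B :: "(complex^'n^'n) set" and \<psi> and \<Lambda> :: "complex^'n^'n \<Rightarrow> complex^'m"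
  assumes B: "unital_star_subalgebra B" and gns: "gns_map B \<psi> \<Lambda>"
begin

lemma gns_basis_in: "gns_basis B \<Lambda> i \<in> B"
  and gns_basis_image: "\<Lambda> (gns_basis B \<Lambda> i) = axis i 1"
  using gns unfolding gns_map_def gns_basis_def
  by (auto simp: bij_betw_def intro!: inv_into_into f_inv_into_f)

lemma gns_map_sum:
  assumes "finite F" "\<And>i. i \<in> F \<Longrightarrow> f i \<in> B"
  shows "(\<Sum>i\<in>F. cscale (c i) (f i)) \<in> B \<and>
    \<Lambda> (\<Sum>i\<in>F. cscale (c i) (f i)) = (\<Sum>i\<in>F. c i *s \<Lambda> (f i))"
  using assms
proof (induction F rule: finite_induct)
  case empty
  have "cmat.subspace B" using B by (simp add: unital_star_subalgebra_def)
  then have 0: "0 \<in> B" by (simp add: cmat.subspace_def)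
  have "\<Lambda> (0 + 0) = \<Lambda> 0 + \<Lambda> 0" using gns 0 unfolding gns_map_def by blast
  then show ?case using 0 by simp
next
  case (insert i F)
  have sub: "cmat.subspace B" using B by (simp add: unital_star_subalgebra_def)
  have 1: "cscale (c i) (f i) \<in> B" using sub insert.prems by (simp add: cmat.subspace_def)
  have 2: "(\<Sum>i\<in>F. cscale (c i) (f i)) \<in> B"
    and 3: "\<Lambda> (\<Sum>i\<in>F. cscale (c i) (f i)) = (\<Sum>i\<in>F. c i *s \<Lambda> (f i))"
    using insert by auto
  have "\<Lambda> (cscale (c i) (f i) + (\<Sum>i\<in>F. cscale (c i) (f i)))
      = c i *s \<Lambda> (f i) + (\<Sum>i\<in>F. c i *s \<Lambda> (f i))"
    using gns 1 2 3 insert.prems unfolding gns_map_def by simp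
  moreover have "cscale (c i) (f i) + (\<Sum>i\<in>F. cscale (c i) (f i)) \<in> B"
    using sub 1 2 by (simp add: cmat.subspace_def)
  ultimately show ?case using insert.hyps by simp
qed

lemma gns_expand:
  assumes "a \<in> B" shows "a = (\<Sum>i\<in>UNIV. cscale (\<Lambda> a $ i) (gns_basis B \<Lambda> i))"
proof -
  let ?a = "\<Sum>i\<in>UNIV. cscale (\<Lambda> a $ i) (gns_basis B \<Lambda> i)"
  have in_B: "?a \<in> B" and eq: "\<Lambda> ?a = (\<Sum>i\<in>UNIV. \<Lambda> a $ i *s axis i 1)"
    using gns_map_sum[of UNIV "gns_basis B \<Lambda>" "\<lambda>i. \<Lambda> a $ i"]
    by (simp_all add: gns_basis_in gns_basis_image)
  have "\<Lambda> ?a = \<Lambda> a" unfolding eq by (rule basis_expansion)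
  moreover have "inj_on \<Lambda> B" using gns by (simp add: gns_map_def bij_betw_def)
  ultimately show ?thesis using in_B assms by (metis inj_onD)
qed

lemma matrix_mult_sum_cscale:
  fixes f g :: "'m \<Rightarrow> complex^'n^'n"
  shows "(\<Sum>i\<in>UNIV. cscale (c i) (f i)) ** (\<Sum>j\<in>UNIV. cscale (d j) (g j))
     = (\<Sum>p\<in>UNIV. cscale (c (fst p) * d (snd p)) (f (fst p) ** g (snd p)))"
proof -
  have "((\<Sum>i\<in>UNIV. cscale (c i) (f i)) ** (\<Sum>j\<in>UNIV. cscale (d j) (g j))) $ k $ l
     = (\<Sum>p\<in>UNIV. cscale (c (fst p) * d (snd p)) (f (fst p) ** g (snd p))) $ k $ l" for k l
  proof -
    have "((\<Sum>i\<in>UNIV. cscale (c i) (f i)) ** (\<Sum>j\<in>UNIV. cscale (d j) (g j))) $ k $ l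
      = (\<Sum>r\<in>UNIV. \<Sum>p\<in>UNIV. c (fst p) * f (fst p) $ k $ r * (d (snd p) * g (snd p) $ r $ l))"
      by (simp add: matrix_matrix_mult_def cscale_def sum_product sum.cartesian_product
          UNIV_Times_UNIV[symmetric] split_beta del: UNIV_Times_UNIV)
    also have "\<dots> = (\<Sum>p\<in>UNIV. \<Sum>r\<in>UNIV.
        c (fst p) * f (fst p) $ k $ r * (d (snd p) * g (snd p) $ r $ l))"
      by (rule sum.swap)
    also have "\<dots> = (\<Sum>p\<in>UNIV. cscale (c (fst p) * d (snd p)) (f (fst p) ** g (snd p))) $ k $ l"
      by (simp add: matrix_matrix_mult_def cscale_def sum_distrib_left mult_ac)
    finally show ?thesis .
  qed
  then show ?thesis by (simp add: vec_eq_iff)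
qed

theorem gns_mult_vtensor:
  assumes "a \<in> B" "b \<in> B"
  shows "gns_mult B \<Lambda> *v vtensor (\<Lambda> a) (\<Lambda> b) = \<Lambda> (a ** b)"
proof -
  let ?g = "gns_basis B \<Lambda>"
  have "a ** b = (\<Sum>p\<in>UNIV. cscale (\<Lambda> a $ fst p * \<Lambda> b $ snd p) (?g (fst p) ** ?g (snd p)))"
    by (subst gns_expand[OF assms(1)], subst gns_expand[OF assms(2)])
      (rule matrix_mult_sum_cscale)
  moreover have "?g i ** ?g j \<in> B" for i j
    using B gns_basis_in by (simp add: unital_star_subalgebra_def)
  ultimately have "\<Lambda> (a ** b)
      = (\<Sum>p\<in>UNIV. (\<Lambda> a $ fst p * \<Lambda> b $ snd p) *s \<Lambda> (?g (fst p) ** ?g (snd p)))"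
    using gns_map_sum[of UNIV "\<lambda>p. ?g (fst p) ** ?g (snd p)"
        "\<lambda>p. \<Lambda> a $ fst p * \<Lambda> b $ snd p"] by simp
  then show ?thesis
    by (simp add: gns_mult_def vtensor_def matrix_vector_mult_def vec_eq_iff mult_ac)
qed

theorem Psi_theta:
  assumes "a \<in> B" "b \<in> B"
  shows "Psi B \<Lambda> Q (theta (\<Lambda> a) (\<Lambda> b)) = kron (cadj a) (modular Q (\<i> / 2) b)"
proof -
  let ?g = "gns_basis B \<Lambda>"
  have mod_add: "modular Q z (\<Sum>i\<in>F. cscale (c i) (f i)) = (\<Sum>i\<in>F. cscale (c i) (modular Q z (f i)))"
    for z F c and f :: "'m \<Rightarrow> complex^'n^'n"
  proof -
    have add: "modular Q z (x + y) = modular Q z x + modular Q z y" for x y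
      by (simp add: modular_def matrix_matrix_mult_def vec_eq_iff sum.distrib algebra_simps
          sum_distrib_left sum_distrib_right)
    have scale: "modular Q z (cscale c x) = cscale c (modular Q z x)" for c x
      by (simp add: modular_def cscale_def matrix_matrix_mult_def vec_eq_iff sum_distrib_left
          sum_distrib_right mult_ac)
    have zero: "modular Q z 0 = 0" using add[of 0 0] by simp
    show ?thesis
      by (induction F rule: infinite_finite_induct) (simp_all add: zero add scale)
  qed
  have a: "cadj a $ k $ l = (\<Sum>j\<in>UNIV. cnj (\<Lambda> a $ j) * cadj (?g j) $ k $ l)" for k l
    by (subst gns_expand[OF assms(1)]) (simp add: cadj_def cscale_def)
  have b: "modular Q (\<i> / 2) b $ k $ l
      = (\<Sum>i\<in>UNIV. \<Lambda> b $ i * modular Q (\<i> / 2) (?g i) $ k $ l)" for k l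
    by (subst gns_expand[OF assms(2)]) (simp add: mod_add, simp add: cscale_def)
  have "kron (cadj a) (modular Q (\<i> / 2) b) $ p $ q
      = Psi B \<Lambda> Q (theta (\<Lambda> a) (\<Lambda> b)) $ p $ q" for p q
  proof -
    have "kron (cadj a) (modular Q (\<i> / 2) b) $ p $ q
      = (\<Sum>j\<in>UNIV. \<Sum>i\<in>UNIV. \<Lambda> b $ i * cnj (\<Lambda> a $ j) *
          (cadj (?g j) $ fst p $ fst q * modular Q (\<i> / 2) (?g i) $ snd p $ snd q))"
      by (simp add: kron_def a b sum_product mult_ac)
    also have "\<dots> = (\<Sum>i\<in>UNIV. \<Sum>j\<in>UNIV. \<Lambda> b $ i * cnj (\<Lambda> a $ j) *
          (cadj (?g j) $ fst p $ fst q * modular Q (\<i> / 2) (?g i) $ snd p $ snd q))"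
      by (rule sum.swap)
    also have "\<dots> = Psi B \<Lambda> Q (theta (\<Lambda> a) (\<Lambda> b)) $ p $ q"
      by (simp add: Psi_def kron_def theta_def cscale_def)
    finally show ?thesis .
  qed
  then show ?thesis by (simp add: vec_eq_iff)
qed

end

end

theory Submission
  imports Defs "HOL-Complex_Analysis.Conformal_Mappings"
begin

text \<open>
  Identify \<open>e = \<Psi>\<^bsub>0,1/2\<^esub>(A)\<close> with the operator \<open>E\<close> on \<open>\<B>(H)\<close>
  sending \<open>T\<close> to the sum of the \<open>a\<^sup>* T \<sigma>\<^bsub>i/2\<^esub>(b)\<close> when \<open>A\<close> is the sum of the
  \<open>\<theta>\<^bsub>\<Lambda>(a),\<Lambda>(b)\<^esub>\<close>; then \<open>S\<close> is the range of \<open>E\<close>.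
  The Schur product of two matrices \<open>A\<close> becomes the composition of the operators \<open>E\<close>, self-adjointness
  of \<open>A\<close> says that \<open>E\<close> commutes with the involution \<open>T \<mapsto> Q\<^sup>-\<^sup>1\<^sup>/\<^sup>2 T\<^sup>* Q\<^sup>1\<^sup>/\<^sup>2\<close>, the
  second condition then makes \<open>E\<close> self-adjoint for the Hilbert-Schmidt inner product, and the third
  one becomes \<open>E(Q\<^sup>-\<^sup>1\<^sup>/\<^sup>2) = Q\<^sup>-\<^sup>1\<^sup>/\<^sup>2\<close>. So \<open>E\<close> is an orthogonal projection which commutes
  with the left and right actions of \<open>B'\<close> and, comparing the involution with its Hilbert-Schmidt adjoint,
  with conjugation by \<open>Q\<close>. Conversely the orthogonal projection onto a self-adjoint \<open>B'\<close>-bimodule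
  commutes with these actions, hence comes from \<open>B \<otimes> B\<^sup>o\<^sup>p\<close> by the double commutant theorem.

  By analytic continuation \<open>q\<^sup>z a q\<^sup>-\<^sup>z = Q\<^sup>z a Q\<^sup>-\<^sup>z\<close> for \<open>a \<in> B\<close>, so \<open>Q\<^sup>-\<^sup>z q\<^sup>z \<in> B'\<close> and \<open>Q\<close> may be
  replaced by \<open>q\<close> for \<open>B'\<close>-bimodules. Finally, a subspace invariant under conjugation by \<open>q\<close>
  is invariant under conjugation by \<open>q\<^sup>1\<^sup>/\<^sup>2\<close>, as the latter is a positive root of the former.
\<close>

section \<open>Hermitian matrices and orthogonal projections\<close>

lemma cinner_add_right: "cinner u (v + w) = cinner u v + cinner u w"
  and cinner_add_left: "cinner (u + v) w = cinner u w + cinner v w"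
  and cinner_diff_right: "cinner u (v - w) = cinner u v - cinner u w"
  by (simp_all add: cinner_def sum.distrib sum_subtractf algebra_simps)

lemma cinner_scale_right: "cinner u (c *s v) = c * cinner u v"
  and cinner_scale_left: "cinner (c *s u) v = cnj c * cinner u v"
  by (simp_all add: cinner_def sum_distrib_left mult_ac)

lemma cinner_zero [simp]: "cinner 0 v = 0" "cinner v 0 = 0"
  by (simp_all add: cinner_def)

lemma cnj_cinner: "cnj (cinner u v) = cinner v u"
  by (simp add: cinner_def mult_ac)

lemma Re_cinner: "Re (cinner u v) = u \<bullet> v"
  by (simp add: cinner_def inner_vec_def inner_complex_def)

lemma cinner_self: "cinner v v = complex_of_real (v \<bullet> v)"
proof -
  have "Im (cinner v v) = 0" by (simp add: cinner_def)
  then show ?thesis by (simp add: complex_eq_iff Re_cinner)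
qed

lemma cinner_self_eq_0 [simp]: "cinner v v = 0 \<longleftrightarrow> v = 0"
  by (simp add: cinner_self)

lemma cinner_ext:
  assumes "\<And>w. cinner w u = cinner w v" shows "u = v"
proof -
  have "cinner (u - v) (u - v) = 0" using assms[of "u - v"] by (simp add: cinner_diff_right)
  then show ?thesis by simp
qed

lemma cadj_cadj [simp]: "cadj (cadj X) = X"
  by (simp add: cadj_def vec_eq_iff)

lemma cadj_add: "cadj (X + Y) = cadj X + cadj Y"
  and cadj_cscale: "cadj (cscale c X) = cscale (cnj c) (cadj X)"
  by (simp_all add: cadj_def cscale_def vec_eq_iff)

lemma cadj_mult: "cadj (X ** Y) = cadj Y ** cadj X"
  by (simp add: cadj_def matrix_matrix_mult_def vec_eq_iff mult_ac)

lemma cadj_mat_1 [simp]: "cadj (mat 1) = mat 1"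
  by (auto simp add: cadj_def mat_def vec_eq_iff)

lemma cadj_eq_iff [simp]: "cadj X = cadj Y \<longleftrightarrow> X = Y"
  by (metis cadj_cadj)

lemma cinner_cadj_right: "cinner \<xi> (cadj X *v \<eta>) = cinner (X *v \<xi>) \<eta>"
  by (metis cinner_cadj cadj_cadj)

lemma cscale_mult_left: "cscale c X ** Y = cscale c (X ** Y)"
  and cscale_mult_right: "X ** cscale c Y = cscale c (X ** Y)"
  by (simp_all add: cscale_def matrix_matrix_mult_def vec_eq_iff sum_distrib_left mult_ac)

lemma cscale_vec: "cscale c X *v v = c *s (X *v v)"
  by (simp add: cscale_def matrix_vector_mult_def vec_eq_iff sum_distrib_left mult_ac)

lemma matrix_mult_diff_right: "X ** (Y - Z) = X ** Y - X ** (Z :: complex^'k^'m)"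
  by (simp add: matrix_matrix_mult_def vec_eq_iff sum_subtractf algebra_simps)

lemma matrix_mult_diff_left: "(Y - Z) ** X = Y ** X - Z ** (X :: complex^'k^'m)"
  by (simp add: matrix_matrix_mult_def vec_eq_iff sum_subtractf algebra_simps)

lemma matrix_mult_add_left: "(Y + Z) ** X = Y ** X + Z ** (X :: complex^'k^'m)"
  by (simp add: matrix_matrix_mult_def vec_eq_iff sum.distrib algebra_simps)

lemma sum_matrix_vector: "(\<Sum>i\<in>F. f i) *v v = (\<Sum>i\<in>F. f i *v (v::complex^'k))"
  by (induction F rule: infinite_finite_induct) (simp_all add: matrix_vector_mult_add_rdistrib)

lemma matrix_vector_sum: "X *v (\<Sum>i\<in>F. f i) = (\<Sum>i\<in>F. X *v (f i :: complex^'k))"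
  by (induction F rule: infinite_finite_induct) (simp_all add: matrix_vector_right_distrib)

lemma matrix_vector_scale: "X *v (c *s v) = c *s (X *v (v :: complex^'k))"
  by (simp add: matrix_vector_mult_def vec_eq_iff sum_distrib_left mult_ac)

lemma sum_matrix_mult: "(\<Sum>i\<in>F. f i) ** Y = (\<Sum>i\<in>F. f i ** (Y::complex^'k^'l))"
  by (induction F rule: infinite_finite_induct) (simp_all add: matrix_mult_add_left)

lemma matrix_mult_sum: "Y ** (\<Sum>i\<in>F. f i) = (\<Sum>i\<in>F. (Y::complex^'l^'k) ** f i)"
  by (induction F rule: infinite_finite_induct) (simp_all add: matrix_add_ldistrib)

lemma matrix_ext:
  assumes "\<And>v. X *v v = Y *v (v::complex^'k)" shows "X = Y"
  using assms by (simp add: matrix_eq)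

lemma scaleR_vec_of_real: "r *\<^sub>R v = complex_of_real r *s (v :: complex^'k)"
  unfolding vec_eq_iff vector_scaleR_component vector_smult_component
  by (simp add: scaleR_conv_of_real)

lemma vec_subspace_imp_subspace:
  assumes "vec.subspace (V :: (complex^'k) set)" shows "subspace V"
proof -
  have "r *\<^sub>R v = complex_of_real r *s v" for r and v :: "complex^'k"
    by (rule scaleR_vec_of_real)
  then show ?thesis
    using assms by (simp add: vec.subspace_def subspace_def)
qed

text \<open>Polarisation: reality of the quadratic form at \<open>v + w\<close> and at
  \<open>\<i> *s v + w\<close> gives two relations between the mixed terms, and adding them isolates
  \<open>cinner w (X *v v)\<close>.\<close>

lemma positive_op_hermitian:
  assumes "positive_op X" shows "cadj X = X"
proof (rule matrix_ext, rule cinner_ext)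
  fix v w
  have real: "cinner u (X *v u) = cinner (X *v u) u" for u
    using assms cnj_cinner[of u "X *v u"] unfolding positive_op_def
    by (metis complex_nonneg_Reals_iff complex_cnj_complex_of_real complex_is_Real_iff
        Reals_cases)
  have 1: "cinner w (X *v v) + cinner v (X *v w) = cinner (X *v w) v + cinner (X *v v) w"
    using real[of "v + w"] real[of v] real[of w]
    by (simp add: matrix_vector_right_distrib cinner_add_left cinner_add_right algebra_simps)
  have 2: "\<i> * cinner w (X *v v) - \<i> * cinner v (X *v w) = \<i> * cinner (X *v w) v - \<i> * cinner (X *v v) w"
    using real[of "\<i> *s v + w"] real[of v] real[of w]
    by (simp add: matrix_vector_right_distrib matrix_vector_scale cinner_add_left cinner_add_right
        cinner_scale_left cinner_scale_right algebra_simps)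
  have "\<i> * (cinner w (X *v v) - cinner v (X *v w)) = \<i> * (cinner (X *v w) v - cinner (X *v v) w)"
    using 2 by (simp add: algebra_simps)
  then have "cinner w (X *v v) - cinner v (X *v w) = cinner (X *v w) v - cinner (X *v v) w"
    by simp
  with 1 have "2 * cinner w (X *v v) = 2 * cinner (X *v w) v" by algebra
  then show "cinner w (cadj X *v v) = cinner w (X *v v)"
    by (simp add: cinner_cadj_right)
qed

text \<open>A maximiser of the real form \<open>v \<bullet> (X *v v)\<close> on the unit sphere of
  \<open>V\<close> is an eigenvector. The invariant subspace \<open>V\<close> is there so that this
  applies to the complement of all eigenspaces.\<close>

lemma hermitian_eigenvector:
  fixes X :: "complex^'k^'k"
  assumes X: "cadj X = X" and V: "vec.subspace V" "V \<noteq> {0}" and inv: "\<And>v. v \<in> V \<Longrightarrow> X *v v \<in> V"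
  shows "\<exists>(l::real) v. v \<in> V \<and> v \<noteq> 0 \<and> X *v v = complex_of_real l *s v"
proof -
  let ?f = "\<lambda>v. v \<bullet> (X *v v)"
  have sub: "subspace V" using V(1) by (rule vec_subspace_imp_subspace)
  have comp: "compact (V \<inter> sphere 0 1)"
    using closed_subspace[OF sub] by (simp add: closed_Int_compact)
  obtain u where "u \<in> V" "u \<noteq> 0" using V vec.subspace_0 by blast
  then have "u /\<^sub>R norm u \<in> V \<inter> sphere 0 1"
    using sub by (simp add: subspace_scale)
  then have ne: "V \<inter> sphere 0 1 \<noteq> {}" by blast
  have "linear ((*v) X)"
    by (intro linearI) (simp_all add: matrix_vector_right_distrib matrix_vector_scale scaleR_vec_of_real)
  then have "continuous_on (V \<inter> sphere 0 1) ?f"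
    by (intro continuous_intros linear_continuous_on linear_conv_bounded_linear[THEN iffD1])
  from continuous_attains_sup[OF comp ne this]
  obtain v where v: "v \<in> V" "norm v = 1" and
    max: "\<And>w. w \<in> V \<Longrightarrow> norm w = 1 \<Longrightarrow> ?f w \<le> ?f v" by auto
  define l where "l = ?f v"
  \<comment> \<open>The form of \<open>Y\<close> is nonnegative on \<open>V\<close> and vanishes at
    the maximiser \<open>v\<close>, so its first variation in the direction \<open>Y v\<close> must
    vanish, which forces \<open>Y v = 0\<close>.\<close>
  define Y where "Y = (\<lambda>w. l *\<^sub>R w - X *v w)"
  have Ylin: "Y (a + t *\<^sub>R b) = Y a + t *\<^sub>R Y b" for a b t
    using \<open>linear ((*v) X)\<close> by (simp add: Y_def linear_add linear_scale algebra_simps)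
  have Ypos: "w \<bullet> Y w \<ge> 0" if "w \<in> V" for w
  proof (cases "w = 0")
    case False
    have "w /\<^sub>R norm w \<in> V" using sub that by (simp add: subspace_scale)
    then have "?f (w /\<^sub>R norm w) \<le> l" unfolding l_def
      by (rule max) (use False in simp)
    moreover have "?f (w /\<^sub>R norm w) = ?f w / (norm w)\<^sup>2"
      using linear_scale[OF \<open>linear ((*v) X)\<close>] by (simp add: power2_eq_square divide_inverse mult.assoc)
    ultimately have "?f w / (norm w)\<^sup>2 \<le> l" by linarith
    then have "?f w \<le> l * (norm w)\<^sup>2" using False by (subst (asm) pos_divide_le_eq) simp_all
    then show ?thesis by (simp add: Y_def inner_diff_right power2_norm_eq_inner)
  qed (simp add: Y_def)
  have Yv0: "v \<bullet> Y v = 0" using v by (simp add: Y_def inner_diff_right l_def norm_eq_1)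
  have sym: "a \<bullet> Y b = Y a \<bullet> b" for a b
  proof -
    have "a \<bullet> (X *v b) = (X *v a) \<bullet> b"
      using cinner_cadj[of X a b] X by (simp flip: Re_cinner)
    then show ?thesis by (simp add: Y_def inner_diff_right inner_diff_left)
  qed
  define w where "w = Y v"
  have "w \<in> V" unfolding w_def Y_def using v inv sub by (simp add: subspace_diff subspace_scale)
  have quad: "2 * t * (w \<bullet> w) + t\<^sup>2 * (w \<bullet> Y w) \<ge> 0" for t
  proof -
    have "v + t *\<^sub>R w \<in> V" using v \<open>w \<in> V\<close> sub by (simp add: subspace_add subspace_scale)
    from Ypos[OF this] show ?thesis
      using sym[of v w] Yv0
      by (simp add: Ylin inner_add_left inner_add_right inner_commute power2_eq_square
          algebra_simps flip: w_def)
  qed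
  have "w \<bullet> w = 0"
  proof (rule ccontr)
    assume "w \<bullet> w \<noteq> 0"
    then have c: "w \<bullet> w > 0" by (simp add: less_le)
    define d where "d = w \<bullet> Y w"
    have d: "d \<ge> 0" using Ypos \<open>w \<in> V\<close> d_def by simp
    \<comment> \<open>For this \<open>t\<close> the linear term of \<open>quad\<close> outweighs the
      quadratic one; the denominator \<open>d + 1\<close> is positive even if
      \<open>d = 0\<close>.\<close>
    define t where "t = - (w \<bullet> w) / (d + 1)"
    have t: "t < 0" using c d by (simp add: t_def divide_less_0_iff)
    have "(w \<bullet> w) * (d / (d + 1)) \<le> (w \<bullet> w) * 1" using d by (intro mult_left_mono) auto
    moreover have "t * d = - ((w \<bullet> w) * (d / (d + 1)))" by (simp add: t_def)
    ultimately have "2 * (w \<bullet> w) + t * d > 0" using c by linarith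
    with t have "t * (2 * (w \<bullet> w) + t * d) < 0" by (rule mult_neg_pos)
    then have "2 * t * (w \<bullet> w) + t\<^sup>2 * d < 0" by (simp add: algebra_simps power2_eq_square)
    then show False using quad[of t] d_def by simp
  qed
  then have "X *v v = l *\<^sub>R v" by (simp add: w_def Y_def)
  also have "\<dots> = complex_of_real l *s v" by (rule scaleR_vec_of_real)
  finally show ?thesis using v by (metis norm_zero zero_neq_one)
qed

definition orth_proj :: "complex^'k^'k \<Rightarrow> (complex^'k) set \<Rightarrow> bool" where
  "orth_proj P V \<longleftrightarrow> cadj P = P \<and> (\<forall>v. P *v v \<in> V) \<and> (\<forall>v\<in>V. P *v v = v)"

lemma orth_proj_idem: "orth_proj P V \<Longrightarrow> P ** P = P"
  by (rule matrix_ext) (simp add: orth_proj_def flip: matrix_vector_mul_assoc)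

lemma orth_proj_range: "orth_proj P V \<Longrightarrow> range ((*v) P) = V"
  unfolding orth_proj_def by (metis (no_types, lifting) image_subset_iff rangeI subsetI subset_antisym)

lemma orth_proj_unique:
  assumes "orth_proj P V" "orth_proj P' V" shows "P = P'"
proof -
  have "P' ** P = P" "P ** P' = P'"
    using assms by (auto intro!: matrix_ext simp: orth_proj_def simp flip: matrix_vector_mul_assoc)
  then show ?thesis
    using assms unfolding orth_proj_def by (metis cadj_mult)
qed

lemma orth_proj_exists:
  fixes V :: "(complex^'k) set"
  assumes V: "vec.subspace V" shows "\<exists>P. orth_proj P V"
proof -
  have sub: "subspace V" using V by (rule vec_subspace_imp_subspace)
  have ex: "\<exists>y. y \<in> V \<and> (\<forall>w\<in>V. cinner w (x - y) = 0)" for x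
  proof -
    obtain y z where y: "y \<in> span V" and z: "\<And>w. w \<in> span V \<Longrightarrow> orthogonal z w" and x: "x = y + z"
      using orthogonal_subspace_decomp_exists[of V x] by metis
    have sp: "span V = V" using sub by (simp add: span_eq_iff)
    have "cinner w z = 0" if w: "w \<in> V" for w
    proof -
      \<comment> \<open>The decomposition is orthogonal for the real inner product; testing also
        against \<open>\<i> *s w\<close> removes the imaginary part.\<close>
      have "\<i> *s w \<in> V" using V w by (simp add: vec.subspace_scale)
      then have "Re (cinner w z) = 0" "Re (cinner (\<i> *s w) z) = 0"
        using z w sp by (metis Re_cinner orthogonal_def inner_commute)+
      then show ?thesis by (simp add: cinner_scale_left complex_eq_iff)
    qed
    with y x sp show ?thesis by auto
  qed
  define f where "f x = (SOME y. y \<in> V \<and> (\<forall>w\<in>V. cinner w (x - y) = 0))" for x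
  have f: "f x \<in> V" "\<And>w. w \<in> V \<Longrightarrow> cinner w (x - f x) = 0" for x
    using someI_ex[OF ex[of x]] by (auto simp: f_def)
  \<comment> \<open>Uniqueness of the foot of the perpendicular, from which linearity of
    \<open>f\<close> and \<open>f v = v\<close> on \<open>V\<close> follow.\<close>
  have f_eq: "f x = y" if "y \<in> V" "\<And>w. w \<in> V \<Longrightarrow> cinner w (x - y) = 0" for x y
  proof -
    have "f x - y \<in> V" using that f V by (simp add: vec.subspace_diff)
    from that(2)[OF this] f(2)[OF this]
    have "cinner (f x - y) (f x - y) = 0" by (simp add: cinner_diff_right algebra_simps)
    then show ?thesis by simp
  qed
  have f2: "cinner w (f x) = cinner w x" if "w \<in> V" for w x
    using f(2)[OF that, of x] by (simp add: cinner_diff_right)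
  have lin: "Vector_Spaces.linear (*s) (*s) f"
  proof
    show "f (a + b) = f a + f b" for a b
      by (intro f_eq vec.subspace_add V f) (simp add: cinner_diff_right cinner_add_right f2)
    show "f (c *s a) = c *s f a" for c a
      by (intro f_eq vec.subspace_scale V f) (simp add: cinner_diff_right cinner_scale_right f2)
  qed
  have mf: "matrix f *v v = f v" for v using lin by (rule matrix_works)
  have "cadj (matrix f) = matrix f"
  proof (rule matrix_ext, rule cinner_ext)
    fix v w
    have "cinner (f w) v = cinner (f w) (f v)" "cinner (f v) w = cinner (f v) (f w)"
      using f(1) by (simp_all add: f2)
    then show "cinner w (cadj (matrix f) *v v) = cinner w (matrix f *v v)"
      by (metis cinner_cadj_right cnj_cinner mf)
  qed
  moreover have "f v = v" if "v \<in> V" for v using that by (intro f_eq) auto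
  ultimately show ?thesis using f by (auto simp: orth_proj_def mf)
qed

text \<open>Invariance of \<open>V\<close> under \<open>M\<close> and \<open>cadj M\<close> gives
  \<open>P ** M ** P = M ** P\<close> and the same for \<open>cadj M\<close>; the adjoint of the
  second identity is \<open>P ** M ** P = P ** M\<close>.\<close>

lemma orth_proj_commute:
  assumes P: "orth_proj P V" and inv: "\<And>v. v \<in> V \<Longrightarrow> M *v v \<in> V" "\<And>v. v \<in> V \<Longrightarrow> cadj M *v v \<in> V"
  shows "P ** M = M ** P"
proof -
  have *: "P ** N ** P = N ** P" if "\<And>v. v \<in> V \<Longrightarrow> N *v v \<in> V" for N
    using P that by (auto intro!: matrix_ext simp: orth_proj_def simp flip: matrix_vector_mul_assoc)
  have "P ** M ** P = M ** P" "P ** cadj M ** P = cadj M ** P" using * inv by blast+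
  then show ?thesis
    using P unfolding orth_proj_def by (metis cadj_cadj cadj_mult matrix_mul_assoc)
qed

section \<open>The spectral theorem for Hermitian matrices\<close>

definition eigenspace :: "complex^'k^'k \<Rightarrow> real \<Rightarrow> (complex^'k) set" where
  "eigenspace X l = {v. X *v v = complex_of_real l *s v}"

lemma eigenspace_subspace: "vec.subspace (eigenspace X l)"
  by (auto simp: eigenspace_def vec.subspace_def matrix_vector_right_distrib matrix_vector_scale
      vec.scale_right_distrib mult.commute)

lemma eigenspace_orthogonal:
  assumes X: "cadj X = X" and "v \<in> eigenspace X l" "w \<in> eigenspace X k" "l \<noteq> k"
  shows "cinner v w = 0"
proof -
  have "complex_of_real l * cinner v w = cinner (X *v v) w"
    using assms by (simp add: eigenspace_def cinner_scale_left)
  also have "\<dots> = cinner v (X *v w)" using cinner_cadj[of X v w] X by simp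
  also have "\<dots> = complex_of_real k * cinner v w"
    using assms by (simp add: eigenspace_def cinner_scale_right)
  finally show ?thesis using \<open>l \<noteq> k\<close> by simp
qed

text \<open>There are finitely many eigenvalues because eigenvectors for distinct ones are
  orthogonal, hence independent. The projections sum to the identity because their common kernel
  contains no eigenvector.\<close>

lemma hermitian_spectral:
  fixes X :: "complex^'k^'k"
  assumes X: "cadj X = X"
  obtains L :: "real set" and P where "finite L" "\<And>l. l \<in> L \<Longrightarrow> eigenspace X l \<noteq> {0}"
    "\<And>l. orth_proj (P l) (eigenspace X l)" "(\<Sum>l\<in>L. P l) = mat 1"
proof -
  define L where "L = {l. eigenspace X l \<noteq> {0}}"
  have "\<exists>P. orth_proj P (eigenspace X l)" for l using eigenspace_subspace by (rule orth_proj_exists)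
  then obtain P where P: "\<And>l. orth_proj (P l) (eigenspace X l)" by metis
  have nz: "\<exists>v. v \<noteq> 0 \<and> v \<in> eigenspace X l" if "l \<in> L" for l
    using that vec.subspace_0[OF eigenspace_subspace] by (fastforce simp: L_def)
  then obtain u where u: "\<And>l. l \<in> L \<Longrightarrow> u l \<noteq> 0 \<and> u l \<in> eigenspace X l" by metis
  have orth: "orthogonal (u l) (u k)" if "l \<in> L" "k \<in> L" "l \<noteq> k" for l k
    using eigenspace_orthogonal[OF X] u that by (metis Re_cinner orthogonal_def zero_complex.sel(1))
  have inj: "inj_on u L"
    using orth u by (metis inj_onI orthogonal_self)
  have "pairwise orthogonal (u ` L)" using orth by (auto simp: pairwise_def)
  moreover have "0 \<notin> u ` L" using u by force
  ultimately have "independent (u ` L)" by (rule pairwise_orthogonal_independent)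
  then have "finite (u ` L)" by (rule independent_imp_finite)
  then have fin: "finite L" using inj by (simp add: finite_image_iff)
  have PP: "P l *v w = 0" if "w \<in> eigenspace X k" "l \<noteq> k" for l k w
  proof (rule cinner_ext)
    fix z
    have "cinner z (P l *v w) = cinner (P l *v z) w"
      using P unfolding orth_proj_def by (metis cinner_cadj)
    also have "\<dots> = 0" using eigenspace_orthogonal[OF X _ that(1)] P that(2) by (metis orth_proj_def)
    finally show "cinner z (P l *v w) = cinner z 0" by simp
  qed
  \<comment> \<open>The joint orthogonal complement of all eigenspaces. It is invariant as each
    \<open>P l\<close> commutes with \<open>X\<close>, so it would contain an eigenvector if it were
    nonzero.\<close>
  define V where "V = {v. \<forall>l. P l *v v = 0}"
  have "vec.subspace V"
    by (auto simp: V_def vec.subspace_def matrix_vector_right_distrib matrix_vector_scale)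
  moreover have "X *v v \<in> V" if "v \<in> V" for v
  proof -
    have "P l ** X = X ** P l" for l
      using P by (rule orth_proj_commute) (simp_all add: X, simp_all add: eigenspace_def matrix_vector_scale)
    then show ?thesis using that
      by (simp add: V_def matrix_vector_mul_assoc) (simp flip: matrix_vector_mul_assoc)
  qed
  ultimately have V0: "V = {0}"
  proof (rule_tac ccontr)
    assume "vec.subspace V" "\<And>v. v \<in> V \<Longrightarrow> X *v v \<in> V" "V \<noteq> {0}"
    from hermitian_eigenvector[OF X this(1,3,2)]
    obtain l v where "v \<in> V" "v \<noteq> 0" "v \<in> eigenspace X l" by (auto simp: eigenspace_def)
    then show False using P[of l] unfolding V_def orth_proj_def mem_Collect_eq by metis
  qed
  have "(\<Sum>l\<in>L. P l) = mat 1"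
  proof (rule matrix_ext)
    fix v
    have "v - (\<Sum>l\<in>L. P l) *v v \<in> V"
    proof -
      have "P k *v (v - (\<Sum>l\<in>L. P l) *v v) = 0" for k
      proof (cases "k \<in> L")
        case True
        have "P k *v ((\<Sum>l\<in>L. P l) *v v) = (\<Sum>l\<in>L. P k *v (P l *v v))"
          by (simp add: sum_matrix_vector matrix_vector_sum)
        also have "\<dots> = (\<Sum>l\<in>L. if l = k then P k *v v else 0)"
        proof (intro sum.cong refl)
          fix l
          have "P l *v v \<in> eigenspace X l" using P by (simp add: orth_proj_def)
          then show "P k *v (P l *v v) = (if l = k then P k *v v else 0)"
            using PP[of _ l k] P[of k] by (auto simp: orth_proj_def)
        qed
        also have "\<dots> = P k *v v" using True fin by simp
        finally show ?thesis by (simp add: matrix_vector_mult_diff_distrib)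
      next
        case False
        then show ?thesis using P[of k] by (auto simp: L_def orth_proj_def)
      qed
      then show ?thesis by (simp add: V_def)
    qed
    then show "(\<Sum>l\<in>L. P l) *v v = mat 1 *v v" using V0 by simp
  qed
  then show thesis using that fin P L_def by blast
qed

section \<open>Functional calculus of positive invertible matrices\<close>

lemma eigenvalue_positive:
  assumes X: "positive_op X" "invertible X" and l: "eigenspace X l \<noteq> {0}" shows "l > 0"
proof -
  obtain v where v: "v \<noteq> 0" "X *v v = complex_of_real l *s v"
    using l vec.subspace_0[OF eigenspace_subspace, of X l] by (fastforce simp: eigenspace_def)
  have "cinner v (X *v v) = complex_of_real (l * (v \<bullet> v))"
    using v by (simp add: cinner_scale_right cinner_self)
  then have "l * (v \<bullet> v) \<ge> 0" using X(1) unfolding positive_op_def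
    by (metis complex_nonneg_Reals_iff Re_complex_of_real)
  moreover have "v \<bullet> v > 0" using v(1) by simp
  ultimately have "l \<ge> 0" by (simp only: zero_le_mult_iff) linarith
  moreover have "l \<noteq> 0"
  proof
    assume "l = 0"
    then have "X *v v = 0" using v by simp
    then show False using v(1) X(2)
      by (metis invertible_def matrix_vector_mul_assoc matrix_vector_mul_lid matrix_vector_mult_0_right)
  qed
  ultimately show ?thesis by simp
qed

text \<open>The eigenvectors span the space by the resolution of the identity. This yields the
  uniqueness in the definition of \<open>mpow\<close> and all its calculation rules.\<close>

lemma hermitian_eigenvector_ext:
  assumes X: "cadj X = X"
    and eq: "\<And>l v. v \<in> eigenspace X l \<Longrightarrow> Y *v v = Z *v v"
  shows "Y = Z"
proof -
  obtain L P where LP: "finite L" "\<And>l. orth_proj (P l) (eigenspace X l)" "(\<Sum>l\<in>L. P l) = mat 1"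
    using hermitian_spectral[OF X] by metis
  show ?thesis
  proof (rule matrix_ext)
    fix v
    have v: "v = (\<Sum>l\<in>L. P l *v v)" using LP(3) by (simp flip: sum_matrix_vector)
    have "Y *v (P l *v v) = Z *v (P l *v v)" for l
      using eq LP(2) by (metis orth_proj_def)
    then show "Y *v v = Z *v v" by (subst (1 2) v) (simp add: matrix_vector_sum)
  qed
qed

text \<open>The sum of the \<open>l powr w\<close> times \<open>P l\<close> has the defining
  property of \<open>mpow X w\<close>. The projections do not depend on \<open>w\<close>, so the
  dependence on \<open>w\<close> is explicit.\<close>

lemma mpow_spectral:
  assumes X: "positive_op X" "invertible X"
  obtains L P where "finite L" "\<And>l. l \<in> L \<Longrightarrow> l > 0" "\<And>l. cadj (P l) = P l"
    "\<And>w. mpow X w = (\<Sum>l\<in>L. cscale (complex_of_real l powr w) (P l))"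
    "\<And>w l v. X *v v = complex_of_real l *s v \<Longrightarrow> mpow X w *v v = (complex_of_real l powr w) *s v"
proof -
  have herm: "cadj X = X" using X(1) by (rule positive_op_hermitian)
  obtain L P where LP: "finite L" "\<And>l. l \<in> L \<Longrightarrow> eigenspace X l \<noteq> {0}"
    "\<And>l. orth_proj (P l) (eigenspace X l)" "(\<Sum>l\<in>L. P l) = mat 1"
    using hermitian_spectral[OF herm] by metis
  have PP: "P k *v v = (if k = l then v else 0)" if v: "v \<in> eigenspace X l" for k l v
  proof (cases "k = l")
    case False
    have "cinner w (P k *v v) = cinner w 0" for w
      using eigenspace_orthogonal[OF herm _ v False] LP(3)[of k]
      by (simp add: orth_proj_def) (metis cinner_cadj)
    then show ?thesis using False by (simp add: cinner_ext)
  qed (use v LP(3) in \<open>auto simp: orth_proj_def\<close>)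
  define M where "M w = (\<Sum>l\<in>L. cscale (complex_of_real l powr w) (P l))" for w
  have M: "M w *v v = (complex_of_real l powr w) *s v" if v: "X *v v = complex_of_real l *s v" for w l v
  proof -
    have v': "v \<in> eigenspace X l" using v by (simp add: eigenspace_def)
    have "M w *v v = (\<Sum>k\<in>L. if k = l then (complex_of_real l powr w) *s v else 0)"
      unfolding M_def sum_matrix_vector by (intro sum.cong) (auto simp: cscale_vec PP[OF v'])
    also have "\<dots> = (complex_of_real l powr w) *s v"
    proof (cases "l \<in> L")
      \<comment> \<open>For \<open>l\<close> outside \<open>L\<close> every \<open>P k\<close> with
        \<open>k \<in> L\<close> annihilates \<open>v\<close>, so \<open>v = 0\<close> and both
        sides vanish.\<close>
      case False
      have "v = (\<Sum>k\<in>L. P k *v v)" using LP(4) by (simp flip: sum_matrix_vector)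
      also have "\<dots> = 0" using False by (intro sum.neutral) (auto simp: PP[OF v'])
      finally show ?thesis by (simp add: if_distrib cong: if_cong)
    qed (use LP(1) in simp)
    finally show ?thesis .
  qed
  have mp: "mpow X w = M w" for w
    unfolding mpow_def
  proof (rule the_equality)
    show "\<forall>l v. X *v v = complex_of_real l *s v \<longrightarrow> M w *v v = (complex_of_real l powr w) *s v"
      using M by blast
  next
    fix Y assume Y: "\<forall>l v. X *v v = complex_of_real l *s v \<longrightarrow> Y *v v = (complex_of_real l powr w) *s v"
    show "Y = M w"
      by (rule hermitian_eigenvector_ext[OF herm]) (metis (mono_tags, lifting) M Y eigenspace_def mem_Collect_eq)
  qed
  show thesis
  proof (rule that[of L P])
    show "finite L" by (rule LP(1))
    show "l > 0" if "l \<in> L" for l using eigenvalue_positive[OF X LP(2)[OF that]] .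
    show "cadj (P l) = P l" for l using LP(3) by (simp add: orth_proj_def)
    show "mpow X w = (\<Sum>l\<in>L. cscale (complex_of_real l powr w) (P l))" for w
      by (simp add: mp M_def)
    show "mpow X w *v v = (complex_of_real l powr w) *s v" if "X *v v = complex_of_real l *s v" for w l v
      using M[OF that] by (simp add: mp)
  qed
qed

lemma mpow_eigenvector:
  assumes "positive_op X" "invertible X" "v \<in> eigenspace X l"
  shows "mpow X w *v v = (complex_of_real l powr w) *s v"
proof (rule mpow_spectral[OF assms(1,2)])
  assume "\<And>w l v. X *v v = complex_of_real l *s v \<Longrightarrow> mpow X w *v v = (complex_of_real l powr w) *s v"
  then show ?thesis using assms(3) by (simp add: eigenspace_def)
qed

context
  fixes X :: "complex^'k^'k"
  assumes X: "positive_op X" "invertible X"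
begin

text \<open>Other values of \<open>l\<close> only have the zero eigenvector. Positivity matters for
  instance in \<open>mpow_zero\<close>, since \<open>0 powr 0\<close> is 0.\<close>

private lemma ext:
  assumes "\<And>l v. l > 0 \<Longrightarrow> v \<in> eigenspace X l \<Longrightarrow> Y *v v = Z *v v" shows "Y = Z"
proof (rule hermitian_eigenvector_ext[OF positive_op_hermitian[OF X(1)]])
  fix l v assume v: "v \<in> eigenspace X l"
  show "Y *v v = Z *v v"
  proof (cases "v = 0")
    case False
    then have "l > 0" using v by (intro eigenvalue_positive[OF X]) blast
    then show ?thesis using assms v by blast
  qed simp
qed

lemma mpow_zero: "mpow X 0 = mat 1"
  by (rule ext) (simp add: mpow_eigenvector[OF X])

lemma mpow_one: "mpow X 1 = X"
  by (rule ext) (simp add: mpow_eigenvector[OF X], simp add: eigenspace_def)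

lemma mpow_add: "mpow X (w + z) = mpow X w ** mpow X z"
  by (rule ext) (simp add: mpow_eigenvector[OF X] matrix_vector_scale powr_add
      flip: matrix_vector_mul_assoc)

lemma mpow_mult_minus: "mpow X w ** mpow X (- w) = mat 1" "mpow X (- w) ** mpow X w = mat 1"
  by (simp_all add: mpow_zero flip: mpow_add)

lemma mpow_commute:
  assumes "Y ** X = X ** Y" shows "Y ** mpow X w = mpow X w ** Y"
proof (rule ext)
  fix l v assume v: "v \<in> eigenspace X l"
  have "X *v (Y *v v) = Y *v (X *v v)" using assms by (simp add: matrix_vector_mul_assoc)
  then have "Y *v v \<in> eigenspace X l" using v by (simp add: eigenspace_def matrix_vector_scale)
  then show "(Y ** mpow X w) *v v = (mpow X w ** Y) *v v"
    using v by (simp add: mpow_eigenvector[OF X] matrix_vector_scale flip: matrix_vector_mul_assoc)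
qed

lemma cadj_mpow: "cadj (mpow X w) = mpow X (cnj w)"
proof -
  obtain L P where LP: "finite L" "\<And>l. l \<in> L \<Longrightarrow> l > 0" "\<And>l. cadj (P l) = P l"
    "\<And>w. mpow X w = (\<Sum>l\<in>L. cscale (complex_of_real l powr w) (P l))"
    using mpow_spectral[OF X] by metis
  have "cadj (\<Sum>l\<in>L. f l) = (\<Sum>l\<in>L. cadj (f l))" for f :: "real \<Rightarrow> complex^'k^'k"
    by (simp add: cadj_def vec_eq_iff)
  moreover have "cnj (complex_of_real l powr w) = complex_of_real l powr cnj w" if "l \<in> L" for l
    using LP(2)[OF that] by (subst cnj_powr) (auto simp: complex_nonpos_Reals_iff)
  ultimately show ?thesis by (simp add: LP(4) cadj_cscale LP(3))
qed

text \<open>Each entry is a finite sum of exponentials in \<open>z\<close>. The factor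
  \<open>c\<close> covers both powers that occur in \<open>modular\<close>.\<close>

lemma holomorphic_mpow: "(\<lambda>z. mpow X (c * z) $ i $ j) holomorphic_on UNIV"
proof -
  obtain L P where LP: "finite L" "\<And>l. l \<in> L \<Longrightarrow> l > 0"
    "\<And>w. mpow X w = (\<Sum>l\<in>L. cscale (complex_of_real l powr w) (P l))"
    using mpow_spectral[OF X] by metis
  have "(\<lambda>z. \<Sum>l\<in>L. complex_of_real l powr (c * z) * P l $ i $ j) holomorphic_on UNIV"
    using LP(2) by (intro holomorphic_intros) force
  then show ?thesis by (simp add: LP(3) cscale_def)
qed

lemma matrix_inv_mpow: "matrix_inv X = mpow X (- 1)"
proof -
  have "matrix_inv X ** X = mat 1"
    using X(2) unfolding invertible_def matrix_inv_def by (rule someI2_ex) simp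
  then show ?thesis
    using mpow_mult_minus(1)[of 1] by (metis mpow_one matrix_mul_assoc matrix_mul_lid matrix_mul_rid)
qed

end

text \<open>The commutator \<open>C = X D - D X\<close> satisfies \<open>C D + D C = 0\<close>, so that \<open>C\<^sup>* D C\<close> and \<open>C D C\<^sup>*\<close>,
  both positive, have opposite traces.\<close>

lemma commute_positive_root:
  fixes X D G :: "complex^'k^'k"
  assumes D: "D = cadj G ** G" and G: "invertible G" and comm: "X ** (D ** D) = (D ** D) ** X"
  shows "X ** D = D ** X"
proof -
  define C where "C = X ** D - D ** X"
  have anti: "C ** D = cscale (- 1) (D ** C)"
  proof -
    have "C ** D + D ** C = 0"
      using comm by (simp add: C_def matrix_mult_diff_left matrix_mult_diff_right matrix_mul_assoc)
    moreover have "cscale (- 1) (D ** C) = - (D ** C)" by (simp add: cscale_def vec_eq_iff)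
    ultimately show ?thesis by (simp add: eq_neg_iff_add_eq_0)
  qed
  have tr: "trace (cadj Y ** Y) = complex_of_real (\<Sum>i\<in>UNIV. \<Sum>j\<in>UNIV. (cmod (Y $ j $ i))\<^sup>2)"
    for Y :: "complex^'k^'k"
    by (simp add: trace_def matrix_matrix_mult_def cadj_def complex_norm_square mult.commute
        del: of_real_power)
  have "trace (cadj (G ** C) ** (G ** C)) = trace (cadj C ** (D ** C))"
    by (simp add: cadj_mult D matrix_mul_assoc)
  also have "\<dots> = - trace (cadj C ** (C ** D))"
    unfolding anti cscale_mult_right by (simp add: trace_def cscale_def sum_negf)
  also have "trace (cadj C ** (C ** D)) = trace ((C ** cadj G) ** (G ** cadj C))"
    using trace_mul_sym[of "cadj C" "C ** D"] by (simp add: D matrix_mul_assoc)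
  also have "\<dots> = trace (cadj (G ** cadj C) ** (G ** cadj C))" by (simp add: cadj_mult)
  finally have "trace (cadj (G ** C) ** (G ** C)) = - trace (cadj (G ** cadj C) ** (G ** cadj C))" .
  then have "(\<Sum>i\<in>UNIV. \<Sum>j\<in>UNIV. (cmod ((G ** C) $ j $ i))\<^sup>2) = - (\<Sum>i\<in>UNIV. \<Sum>j\<in>UNIV. (cmod ((G ** cadj C) $ j $ i))\<^sup>2)"
    by (simp only: tr of_real_minus[symmetric] of_real_eq_iff)
  moreover have nonneg: "(\<Sum>i\<in>UNIV. \<Sum>j\<in>UNIV. (cmod (Y $ j $ i))\<^sup>2) \<ge> 0" for Y :: "complex^'k^'k"
    by (intro sum_nonneg zero_le_power2)
  ultimately have "(\<Sum>i\<in>UNIV. \<Sum>j\<in>UNIV. (cmod ((G ** C) $ j $ i))\<^sup>2) = 0"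
    using nonneg[of "G ** C"] nonneg[of "G ** cadj C"] by linarith
  then have "\<forall>i j. (G ** C) $ j $ i = 0"
    by (simp add: sum_nonneg_eq_0_iff sum_nonneg)
  then have "G ** C = 0" by (simp add: vec_eq_iff)
  then have "C = 0"
  proof -
    obtain G' where "G' ** G = mat 1" using G by (auto simp: invertible_def)
    then have "C = G' ** (G ** C)" by (simp add: matrix_mul_assoc)
    also have "\<dots> = 0" unfolding \<open>G ** C = 0\<close> by (simp add: matrix_matrix_mult_def vec_eq_iff)
    finally show ?thesis .
  qed
  then show ?thesis by (simp add: C_def)
qed

section \<open>Kronecker products and the double commutant theorem\<close>

text \<open>Both sides are entire in the exponent, entry by entry, and agree on the imaginary axis,
  which has an accumulation point.\<close>

lemma modular_analytic_continuation:
  fixes X Y a :: "complex^'k^'k"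
  assumes X: "positive_op X" "invertible X" and Y: "positive_op Y" "invertible Y"
    and eq: "\<And>t::real. mpow X (\<i> * of_real t) ** a ** mpow X (- (\<i> * of_real t)) =
      mpow Y (\<i> * of_real t) ** a ** mpow Y (- (\<i> * of_real t))"
  shows "mpow X w ** a ** mpow X (- w) = mpow Y w ** a ** mpow Y (- w)"
proof -
  define f where "f Z k l z = (mpow Z (\<i> * z) ** a ** mpow Z ((- \<i>) * z)) $ k $ l"
    for Z :: "complex^'k^'k" and k l z
  have hol: "f Z k l holomorphic_on UNIV" if "positive_op Z" "invertible Z" for Z k l
    unfolding f_def matrix_matrix_mult_def vec_lambda_beta
    by (intro holomorphic_intros holomorphic_mpow that)
  have lim: "(0::complex) islimpt range complex_of_real"
    unfolding islimpt_approachable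
  proof (intro allI impI)
    fix e :: real assume "e > 0"
    then show "\<exists>x'\<in>range complex_of_real. x' \<noteq> 0 \<and> dist x' 0 < e"
      by (intro bexI[of _ "complex_of_real (e / 2)"] rangeI) auto
  qed
  have zero: "f X k l z - f Y k l z = 0" for k l z
  proof (rule analytic_continuation[of "\<lambda>z. f X k l z - f Y k l z" UNIV])
    show "(\<lambda>z. f X k l z - f Y k l z) holomorphic_on UNIV"
      by (intro holomorphic_intros hol X Y)
    show "f X k l z - f Y k l z = 0" if "z \<in> range complex_of_real" for z
      using that eq by (auto simp: f_def)
  qed (use lim in auto)
  \<comment> \<open>The argument of \<open>f\<close> is multiplied by \<open>\<i>\<close> in the
    exponent, so \<open>- \<i> * w\<close> produces the power \<open>w\<close>.\<close>
  have "f X k l (- \<i> * w) = f Y k l (- \<i> * w)" for k l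
    using zero[of k l "- \<i> * w"] by simp
  then show ?thesis
    by (simp add: f_def vec_eq_iff flip: mult.assoc)
qed

lemma sum_UNIV_prod: "(\<Sum>p\<in>UNIV. f p) = (\<Sum>a\<in>UNIV. \<Sum>b\<in>UNIV. f (a, b))"
  by (simp add: sum.cartesian_product flip: UNIV_Times_UNIV)

lemma kron_mult: "kron X Y ** kron Z U = kron (X ** Z) (Y ** U)"
  by (simp add: kron_def matrix_matrix_mult_def vec_eq_iff sum_product sum_UNIV_prod mult_ac)

lemma cadj_kron: "cadj (kron X Y) = kron (cadj X) (cadj Y)"
  by (simp add: cadj_def kron_def vec_eq_iff)

lemma kron_mat_1: "kron (mat 1) (mat 1) = mat 1"
  by (simp add: kron_def mat_def vec_eq_iff prod_eq_iff)

lemma kron_add_left: "kron (X + Y) Z = kron X Z + kron Y Z"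
  and kron_cscale_left: "kron (cscale c X) Z = cscale c (kron X Z)"
  and kron_cscale_right: "kron X (cscale c Z) = cscale c (kron X Z)"
  by (simp_all add: kron_def cscale_def vec_eq_iff algebra_simps)

lemma kron_add_right: "kron X (Y + Z) = kron X Y + kron X Z"
  by (simp add: kron_def vec_eq_iff algebra_simps)

lemma transpose_mult: "transpose (X ** Y) = transpose Y ** transpose (X :: complex^'k^'l)"
  by (rule matrix_transpose_mul)

lemma transpose_cadj: "cadj (transpose X) = transpose (cadj X)"
  by (simp add: cadj_def transpose_def vec_eq_iff)

lemma transpose_cscale: "transpose (cscale c X) = cscale c (transpose X)"
  and transpose_add: "transpose (X + X') = transpose X + transpose X'"
  by (simp_all add: cscale_def transpose_def vec_eq_iff)

lemma opvec_add: "opvec (S + T) = opvec S + opvec T"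
  and opvec_cscale: "opvec (cscale c S) = c *s opvec S"
  by (simp_all add: opvec_def cscale_def vec_eq_iff)

lemma opvec_eq_iff [simp]: "opvec S = opvec T \<longleftrightarrow> S = T"
  by (auto simp: opvec_def vec_eq_iff)

lemma opvec_surj: "\<exists>T. v = opvec T"
  by (rule exI[of _ "\<chi> i j. v $ (i, j)"]) (simp add: opvec_def vec_eq_iff)

lemma kron_opvec: "kron a (transpose b) *v opvec T = opvec (a ** T ** b)"
proof -
  have "(kron a (transpose b) *v opvec T) $ p = opvec (a ** T ** b) $ p" for p
  proof -
    have "(kron a (transpose b) *v opvec T) $ p
        = (\<Sum>i\<in>UNIV. \<Sum>j\<in>UNIV. a $ fst p $ i * T $ i $ j * b $ j $ snd p)"
      by (simp add: kron_def opvec_def transpose_def matrix_vector_mult_def sum_UNIV_prod mult_ac)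
    also have "\<dots> = (\<Sum>j\<in>UNIV. \<Sum>i\<in>UNIV. a $ fst p $ i * T $ i $ j * b $ j $ snd p)"
      by (rule sum.swap)
    also have "\<dots> = opvec (a ** T ** b) $ p"
      by (simp add: opvec_def matrix_matrix_mult_def sum_distrib_right)
    finally show ?thesis .
  qed
  then show ?thesis by (simp add: vec_eq_iff)
qed

lemma kron_opvec_left: "kron a (mat 1) *v opvec T = opvec (a ** T)"
  using kron_opvec[of a "mat 1" T] by (simp add: transpose_mat)

lemma subspace_opvec: "cmat.subspace S \<Longrightarrow> vec.subspace (opvec ` S)"
  unfolding cmat.subspace_def vec.subspace_def
  by (auto simp flip: opvec_add opvec_cscale intro!: image_eqI[of 0 opvec 0])
    (simp add: opvec_def vec_eq_iff)

text \<open>The coefficient of \<open>M\<close> at the matrix unit \<open>(p, q)\<close> of the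
  second tensor factor. Commuting with \<open>kron x (mat 1)\<close> can be tested slice by
  slice.\<close>

definition slice :: "complex^('a::finite \<times> 'b::finite)^('c::finite \<times> 'd::finite) \<Rightarrow> 'd \<Rightarrow> 'b \<Rightarrow> complex^'a^'c" where
  "slice M p q = (\<chi> i j. M $ (i, p) $ (j, q))"

lemma slice_eqI: "(\<And>p q. slice M p q = slice N p q) \<Longrightarrow> M = N"
  by (simp add: slice_def vec_eq_iff)

lemma slice_kron_mult_left: "slice (kron x (mat 1) ** M) p q = x ** slice M p q"
  by (simp add: slice_def kron_def matrix_matrix_mult_def vec_eq_iff sum_UNIV_prod mat_def
      if_distrib if_distribR cong: if_cong)

lemma slice_kron_mult_right: "slice (M ** kron x (mat 1)) p q = slice M p q ** x"
  by (simp add: slice_def kron_def matrix_matrix_mult_def vec_eq_iff sum_UNIV_prod mat_def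
      if_distrib if_distribR cong: if_cong)

lemma kron_commute_iff:
  "kron x (mat 1) ** M = M ** kron x (mat 1) \<longleftrightarrow> (\<forall>p q. x ** slice M p q = slice M p q ** x)"
  by (metis slice_eqI slice_kron_mult_left slice_kron_mult_right)

lemma commutant_star_subalgebra:
  assumes "unital_star_subalgebra B" shows "unital_star_subalgebra (commutant B)"
proof -
  have "cadj x \<in> commutant B" if x: "x \<in> commutant B" for x
  proof -
    have "cadj (x ** cadj a) = cadj (cadj a ** x)" if "a \<in> B" for a
      using x assms that by (simp add: commutant_def unital_star_subalgebra_def)
    then show ?thesis by (simp add: commutant_def cadj_mult)
  qed
  moreover have "x ** y ** a = a ** (x ** y)" if "x \<in> commutant B" "y \<in> commutant B" "a \<in> B" for x y a
    using that unfolding commutant_def by (metis (mono_tags, lifting) matrix_mul_assoc mem_Collect_eq)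
  ultimately show ?thesis
    by (auto simp: unital_star_subalgebra_def cmat.subspace_def commutant_def matrix_add_ldistrib
        matrix_mult_add_left cscale_mult_left cscale_mult_right)
qed

text \<open>With \<open>P\<close> the orthogonal projection of \<open>\<B>(H)\<close> onto \<open>B\<close>, the slices of \<open>P\<close> lie in \<open>B'\<close>, so that
  left multiplication by \<open>T \<in> B''\<close> commutes with \<open>P\<close> and \<open>T = T P(1) = P(T)\<close>.\<close>

theorem double_commutant:
  assumes B: "unital_star_subalgebra B" shows "commutant (commutant B) = B"
proof
  show "B \<subseteq> commutant (commutant B)" by (auto simp: commutant_def)
next
  have "vec.subspace (opvec ` B)"
    using B by (intro subspace_opvec) (simp add: unital_star_subalgebra_def)
  then obtain P where P: "orth_proj P (opvec ` B)" using orth_proj_exists by blast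
  have left: "kron b (mat 1) *v v \<in> opvec ` B" if bv: "b \<in> B" "v \<in> opvec ` B" for b v
  proof -
    obtain T where "T \<in> B" "v = opvec T" using bv by blast
    then show ?thesis using bv B by (simp add: kron_opvec_left unital_star_subalgebra_def)
  qed
  have comm: "P ** kron b (mat 1) = kron b (mat 1) ** P" if b: "b \<in> B" for b
  proof (rule orth_proj_commute[OF P])
    have "cadj b \<in> B" using B b by (simp add: unital_star_subalgebra_def)
    then show "cadj (kron b (mat 1)) *v v \<in> opvec ` B" if "v \<in> opvec ` B" for v
      using left that unfolding cadj_kron cadj_mat_1 by blast
  qed (use left b in blast)
  have slices: "slice P p q \<in> commutant B" for p q
  proof -
    have "b ** slice P p q = slice P p q ** b" if "b \<in> B" for b
      using comm[OF that] kron_commute_iff[of b P] by metis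
    then show ?thesis by (simp add: commutant_def)
  qed
  show "commutant (commutant B) \<subseteq> B"
  proof
    fix T assume "T \<in> commutant (commutant B)"
    then have comm: "kron T (mat 1) ** P = P ** kron T (mat 1)"
      using slices by (simp add: kron_commute_iff commutant_def)
    have "opvec (mat 1) = P *v opvec (mat 1)"
      using P B by (simp add: orth_proj_def unital_star_subalgebra_def)
    moreover have T: "kron T (mat 1) *v opvec (mat 1) = opvec T"
      by (simp add: kron_opvec_left)
    ultimately have "opvec T = P *v opvec T"
      using comm by (metis matrix_vector_mul_assoc)
    then have "opvec T \<in> opvec ` B" using P by (metis orth_proj_def)
    then show "T \<in> B" by auto
  qed
qed

text \<open>Powers of \<open>X\<close> commute with all that commutes with \<open>X\<close>, so they
  lie in the double commutant of \<open>B\<close>.\<close>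

lemma mpow_in_star_subalgebra:
  assumes "unital_star_subalgebra B" "X \<in> B" "positive_op X" "invertible X"
  shows "mpow X w \<in> B"
proof -
  have "x ** X = X ** x" if "x \<in> commutant B" for x
    using that assms(2) by (simp add: commutant_def)
  then have "mpow X w \<in> commutant (commutant B)"
    using mpow_commute[OF assms(3,4)] by (simp add: commutant_def)
  then show ?thesis by (simp add: double_commutant assms(1))
qed

section \<open>Quantum adjacency matrices as operators on matrices\<close>

definition mlinear :: "(complex^'a^'b \<Rightarrow> complex^'c^'d) \<Rightarrow> bool" where
  "mlinear f \<longleftrightarrow> (\<forall>X Y. f (X + Y) = f X + f Y) \<and> (\<forall>c X. f (cscale c X) = cscale c (f X))"

lemma mlinear_add: "mlinear f \<Longrightarrow> f (X + Y) = f X + f Y"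
  and mlinear_cscale: "mlinear f \<Longrightarrow> f (cscale c X) = cscale c (f X)"
  by (simp_all add: mlinear_def)

lemma mlinear_zero: "mlinear f \<Longrightarrow> f 0 = 0"
  using mlinear_cscale[of f 0 0] by simp

lemma mlinear_sum:
  assumes "mlinear f" shows "f (\<Sum>i\<in>F. h i) = (\<Sum>i\<in>F. f (h i))"
  by (induction F rule: infinite_finite_induct) (simp_all add: mlinear_zero mlinear_add assms)

named_theorems mlinear_intros

lemma mlinear_ident [mlinear_intros]: "mlinear (\<lambda>X. X)"
  by (simp add: mlinear_def)

lemma mlinear_mult_right [mlinear_intros]: "mlinear f \<Longrightarrow> mlinear (\<lambda>X. M ** f X)"
  by (simp add: mlinear_def cscale_mult_right matrix_add_ldistrib)

lemma mlinear_mult_left [mlinear_intros]: "mlinear f \<Longrightarrow> mlinear (\<lambda>X. f X ** M)"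
  by (simp add: mlinear_def cscale_mult_left matrix_mult_add_left)

lemma mlinear_kron_left [mlinear_intros]: "mlinear f \<Longrightarrow> mlinear (\<lambda>X. kron (f X) M)"
  by (simp add: mlinear_def kron_add_left kron_cscale_left)

lemma mlinear_kron_right [mlinear_intros]: "mlinear f \<Longrightarrow> mlinear (\<lambda>X. kron M (f X))"
  by (simp add: mlinear_def kron_add_right kron_cscale_right)

lemma mlinear_transpose [mlinear_intros]: "mlinear f \<Longrightarrow> mlinear (\<lambda>X. transpose (f X))"
  by (simp add: mlinear_def transpose_add transpose_cscale)

text \<open>The inner \<open>cadj\<close> compensates for the conjugate-linearity of the outer
  one.\<close>

lemma mlinear_cadj [mlinear_intros]: "mlinear f \<Longrightarrow> mlinear (\<lambda>X. cadj (f (cadj X)))"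
  by (simp add: mlinear_def cadj_add cadj_cscale)

definition unopvec :: "complex^('n::finite \<times> 'n) \<Rightarrow> complex^'n^'n" where
  "unopvec v = (\<chi> i j. v $ (i, j))"

lemma unopvec_opvec [simp]: "unopvec (opvec T) = T"
  and opvec_unopvec [simp]: "opvec (unopvec v) = v"
  by (simp_all add: unopvec_def opvec_def vec_eq_iff)

lemma mlinear_unopvec [mlinear_intros]: "mlinear f \<Longrightarrow> mlinear (\<lambda>X. unopvec (f X *v v))"
  by (simp add: mlinear_def matrix_vector_mult_add_rdistrib cscale_vec)
    (simp add: unopvec_def cscale_def vec_eq_iff)

text \<open>The matrix of \<open>T \<mapsto> (M (T\<^sup>*))\<^sup>*\<close> on \<open>\<B>(H)\<close>.\<close>

definition swapconj :: "complex^('n::finite \<times> 'n)^('n \<times> 'n) \<Rightarrow> complex^('n \<times> 'n)^('n \<times> 'n)" where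
  "swapconj M = (\<chi> p q. cnj (M $ (snd p, fst p) $ (snd q, fst q)))"

lemma swapconj_opvec:
  assumes "M *v opvec T = opvec U" shows "swapconj M *v opvec (cadj T) = opvec (cadj U)"
proof -
  have "cnj ((M *v opvec T) $ (snd p, fst p)) = cnj (opvec U $ (snd p, fst p))" for p
    using assms by simp
  moreover have "cnj ((M *v opvec T) $ (snd p, fst p)) = (swapconj M *v opvec (cadj T)) $ p" for p
    by (simp add: swapconj_def matrix_vector_mult_def opvec_def cadj_def sum_UNIV_prod)
      (rule sum.swap)
  ultimately show ?thesis by (simp add: vec_eq_iff opvec_def cadj_def)
qed

lemma cadj_swapconj: "cadj (swapconj M) = swapconj (cadj M)"
  by (simp add: cadj_def swapconj_def vec_eq_iff)

lemma swapconj_kron: "swapconj (kron x (transpose y)) = kron (cadj y) (transpose (cadj x))"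
  by (simp add: swapconj_def kron_def transpose_def cadj_def vec_eq_iff)

lemma mlinear_swapconj [mlinear_intros]: "mlinear f \<Longrightarrow> mlinear (\<lambda>X. swapconj (f (cadj X)))"
  by (simp add: mlinear_def cadj_add cadj_cscale) (simp add: swapconj_def cscale_def vec_eq_iff)

lemma cadj_theta: "cadj (theta x y) = theta y x"
  by (simp add: cadj_def theta_def vec_eq_iff)

lemma matrix_mult_theta: "M ** theta x y = theta x (M *v y)"
  by (simp add: theta_def matrix_matrix_mult_def matrix_vector_mult_def vec_eq_iff
      sum_distrib_left mult_ac)

lemma theta_mult_matrix: "theta x y ** M = theta (cadj M *v x) y"
  by (metis cadj_cadj cadj_mult cadj_theta matrix_mult_theta)

lemma kron_theta: "kron (theta x y) (theta z w) = theta (vtensor x z) (vtensor y w)"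
  by (simp add: kron_def theta_def vtensor_def vec_eq_iff)

lemma matrix_theta_expand:
  fixes A :: "complex^'k^'l"
  shows "A = (\<Sum>i\<in>UNIV. \<Sum>j\<in>UNIV. cscale (A $ i $ j) (theta (axis j 1) (axis i 1)))"
proof -
  have "(\<Sum>i\<in>UNIV. \<Sum>j\<in>UNIV. cscale (A $ i $ j) (theta (axis j 1) (axis i 1))) $ k $ l = A $ k $ l" for k l
  proof -
    have "cscale (A $ i $ j) (theta (axis j 1) (axis i 1)) $ k $ l
      = (if i = k then if j = l then A $ i $ j else 0 else 0)" for i j
      by (simp add: theta_def cscale_def axis_def)
    then have "(\<Sum>i\<in>UNIV. \<Sum>j\<in>UNIV. cscale (A $ i $ j) (theta (axis j 1) (axis i 1))) $ k $ l
      = (\<Sum>i\<in>UNIV. \<Sum>j\<in>UNIV. if i = k then if j = l then A $ i $ j else 0 else 0)"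
      by simp
    also have "\<dots> = (\<Sum>i\<in>UNIV. if i = k then A $ i $ l else 0)"
      by (intro sum.cong refl) simp
    finally show ?thesis by simp
  qed
  then show ?thesis by (simp add: vec_eq_iff)
qed

text \<open>The partial inner product against \<open>x\<close> in the first factor, that is, the
  adjoint of \<open>w \<mapsto> vtensor x w\<close>, as \<open>cinner_contract_left\<close>
  confirms.\<close>

definition contract_left :: "complex^'a \<Rightarrow> complex^('a::finite \<times> 'b::finite) \<Rightarrow> complex^'b" where
  "contract_left x u = (\<chi> j. \<Sum>i\<in>UNIV. cnj (x $ i) * u $ (i, j))"

definition contract_right :: "complex^'b \<Rightarrow> complex^('a::finite \<times> 'b::finite) \<Rightarrow> complex^'a" where
  "contract_right x u = (\<chi> i. \<Sum>j\<in>UNIV. cnj (x $ j) * u $ (i, j))"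

lemma cinner_contract_left: "cinner w (contract_left x u) = cinner (vtensor x w) u"
proof -
  have "cinner w (contract_left x u) = (\<Sum>j\<in>UNIV. \<Sum>i\<in>UNIV. cnj (x $ i) * cnj (w $ j) * u $ (i, j))"
    by (simp add: cinner_def contract_left_def sum_distrib_left mult_ac)
  also have "\<dots> = (\<Sum>i\<in>UNIV. \<Sum>j\<in>UNIV. cnj (x $ i) * cnj (w $ j) * u $ (i, j))"
    by (rule sum.swap)
  also have "\<dots> = cinner (vtensor x w) u" by (simp add: cinner_def vtensor_def sum_UNIV_prod)
  finally show ?thesis .
qed

lemma cinner_contract_right: "cinner w (contract_right x u) = cinner (vtensor w x) u"
  by (simp add: cinner_def contract_right_def vtensor_def sum_UNIV_prod sum_distrib_left mult_ac)

lemma kron_theta_mat_1: "kron (theta x y) (mat 1) *v u = vtensor y (contract_left x u)"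
  by (simp add: kron_def theta_def matrix_vector_mult_def vtensor_def contract_left_def vec_eq_iff
      sum_UNIV_prod mat_def sum_distrib_left mult_ac if_distrib if_distribR cong: if_cong)

lemma assoc_op_apply: "(assoc_op *v u) $ (i, (j, k)) = u $ ((i, j), k)"
proof -
  have "((i, (j, k)) = (fst (fst q), (snd (fst q), snd q))) = (q = ((i, j), k))" for q
    by (metis fst_conv prod.collapse snd_conv)
  then show ?thesis
    by (simp add: assoc_op_def matrix_vector_mult_def if_distrib if_distribR cong: if_cong)
qed

text \<open>The middle part of the second adjacency condition for a rank-one matrix:
  \<open>x\<close> is contracted with the second leg of \<open>w\<close>, and \<open>y\<close> is
  inserted in its place.\<close>

lemma kron_mat_1_theta_assoc:
  "kron (mat 1) (kron (theta x y) (mat 1)) *v (assoc_op *v vtensor w \<zeta>)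
     = vtensor (contract_right x w) (vtensor y \<zeta>)"
proof -
  have "(kron (mat 1) (kron (theta x y) (mat 1)) *v (assoc_op *v vtensor w \<zeta>)) $ (i, (j, k))
      = vtensor (contract_right x w) (vtensor y \<zeta>) $ (i, (j, k))" for i j k
  proof -
    have "(kron (mat 1) (kron (theta x y) (mat 1)) *v (assoc_op *v vtensor w \<zeta>)) $ (i, (j, k))
      = (\<Sum>i'\<in>UNIV. \<Sum>j'\<in>UNIV. \<Sum>k'\<in>UNIV. (if i = i' then 1 else 0) *
          (y $ j * cnj (x $ j') * (if k = k' then 1 else 0)) * (w $ (i', j') * \<zeta> $ k'))"
      by (subst matrix_vector_mult_def)
        (simp add: sum_UNIV_prod kron_def mat_def theta_def assoc_op_apply, simp add: vtensor_def)
    also have "\<dots> = (\<Sum>i'\<in>UNIV. \<Sum>j'\<in>UNIV. \<Sum>k'\<in>UNIV.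
        if k = k' then if i = i' then y $ j * cnj (x $ j') * w $ (i', j') * \<zeta> $ k' else 0 else 0)"
      by (intro sum.cong refl) (simp split: if_split)
    also have "\<dots> = (\<Sum>i'\<in>UNIV. if i = i' then (\<Sum>j'\<in>UNIV. y $ j * cnj (x $ j') * w $ (i', j') * \<zeta> $ k) else 0)"
      by (intro sum.cong refl) simp
    also have "\<dots> = (\<Sum>j'\<in>UNIV. y $ j * cnj (x $ j') * w $ (i, j') * \<zeta> $ k)" by simp
    also have "\<dots> = vtensor (contract_right x w) (vtensor y \<zeta>) $ (i, (j, k))"
      by (simp add: vtensor_def contract_right_def sum_distrib_left mult_ac)
    finally show ?thesis .
  qed
  then show ?thesis by (simp add: vec_eq_iff)
qed

section \<open>The operator on matrices attached to a matrix on the GNS space\<close>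

locale gns_space =
  fixes B :: "(complex^'n^'n) set" and \<psi> tr :: "complex^'n^'n \<Rightarrow> complex" and Q :: "complex^'n^'n"
    and \<Lambda> :: "complex^'n^'n \<Rightarrow> complex^'m"
  assumes B: "unital_star_subalgebra B" and Q: "Q \<in> B" "positive_op Q" "invertible Q"
    and state: "a \<in> B \<Longrightarrow> \<psi> a = tr (Q ** a)"
    and tracial: "a \<in> B \<Longrightarrow> b \<in> B \<Longrightarrow> tr (a ** b) = tr (b ** a)"
    and gns: "gns_map B \<psi> \<Lambda>"
begin

abbreviation R :: "complex \<Rightarrow> complex^'n^'n" where "R \<equiv> mpow Q"
abbreviation g :: "'m \<Rightarrow> complex^'n^'n" where "g \<equiv> gns_basis B \<Lambda>"

lemma B_mult: "a \<in> B \<Longrightarrow> b \<in> B \<Longrightarrow> a ** b \<in> B"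
  and B_cadj: "a \<in> B \<Longrightarrow> cadj a \<in> B"
  and B_one: "mat 1 \<in> B"
  using B by (simp_all add: unital_star_subalgebra_def)

lemma B_R: "R w \<in> B"
  using B Q by (intro mpow_in_star_subalgebra)

lemmas B_closed = B_mult B_cadj B_one B_R Q(1)

lemma commutant_iff: "T \<in> B \<longleftrightarrow> (\<forall>x\<in>commutant B. x ** T = T ** x)"
  using double_commutant[OF B] by (force simp: commutant_def)

lemma \<Lambda>_inner: "a \<in> B \<Longrightarrow> b \<in> B \<Longrightarrow> cinner (\<Lambda> a) (\<Lambda> b) = \<psi> (cadj a ** b)"
  using gns by (simp add: gns_map_def)

lemma \<Lambda>_surj: obtains a where "a \<in> B" "v = \<Lambda> a"
  using gns unfolding gns_map_def bij_betw_def by (metis UNIV_I imageE)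

lemma g_in: "g i \<in> B" and \<Lambda>_g: "\<Lambda> (g i) = axis i 1"
  using gns_basis_in[OF B gns] gns_basis_image[OF B gns] by auto

lemma R_mult: "R w ** R z = R (w + z)"
  and R_mult_assoc: "R w ** (R z ** X) = R (w + z) ** X"
  and R_zero: "R 0 = mat 1" and R_one: "R 1 = Q"
  using mpow_add[OF Q(2,3)] mpow_zero[OF Q(2,3)] mpow_one[OF Q(2,3)]
  by (simp_all add: matrix_mul_assoc)

lemma cadj_R_half: "cadj (R (1/2)) = R (1/2)" "cadj (R (- (1/2))) = R (- (1/2))"
  by (simp_all add: cadj_mpow[OF Q(2,3)])

lemma Q_mult: "Q ** R z = R (1 + z)" "R z ** Q = R (z + 1)"
   "Q ** (R z ** X) = R (1 + z) ** X" "R z ** (Q ** X) = R (z + 1) ** X"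
  using R_mult[of 1 z] R_mult[of z 1] R_mult_assoc[of 1 z] R_mult_assoc[of z 1] by (simp_all add: R_one)

text \<open>The inverse of \<open>\<Lambda>\<close>, written in the basis so that linearity holds by
  construction.\<close>

definition \<Lambda>inv :: "complex^'m \<Rightarrow> complex^'n^'n" where
  "\<Lambda>inv v = (\<Sum>i\<in>UNIV. cscale (v $ i) (g i))"

lemma \<Lambda>inv_\<Lambda>: "a \<in> B \<Longrightarrow> \<Lambda>inv (\<Lambda> a) = a"
  unfolding \<Lambda>inv_def using gns_expand[OF B gns] by simp

lemma \<Lambda>_\<Lambda>inv: "\<Lambda> (\<Lambda>inv v) = v"
  by (rule \<Lambda>_surj[of v]) (simp add: \<Lambda>inv_\<Lambda>)

lemma \<Lambda>inv_add: "\<Lambda>inv (v + w) = \<Lambda>inv v + \<Lambda>inv w"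
  and \<Lambda>inv_scale: "\<Lambda>inv (c *s v) = cscale c (\<Lambda>inv v)"
  by (simp_all add: \<Lambda>inv_def cmat.scale_left_distrib sum.distrib cmat.scale_sum_right)

lemma mlinear_\<Lambda>inv [mlinear_intros]: "mlinear f \<Longrightarrow> mlinear (\<lambda>X. \<Lambda>inv (f X *v v))"
  by (simp add: mlinear_def matrix_vector_mult_add_rdistrib cscale_vec \<Lambda>inv_add \<Lambda>inv_scale)

text \<open>The matrix units are of the form \<open>theta (\<Lambda> a) (\<Lambda> b)\<close> with
  \<open>a\<close>, \<open>b\<close> basis elements of \<open>B\<close>. Every linear identity in
  \<open>A\<close> below is reduced to this rank-one case.\<close>

lemma theta_ext:
  assumes f: "mlinear f" "mlinear f'"
    and eq: "\<And>a b. a \<in> B \<Longrightarrow> b \<in> B \<Longrightarrow> f (theta (\<Lambda> a) (\<Lambda> b)) = f' (theta (\<Lambda> a) (\<Lambda> b))"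
  shows "f A = f' A"
proof -
  have *: "f (theta (axis j 1) (axis i 1)) = f' (theta (axis j 1) (axis i 1))" for i j
    using eq[OF g_in g_in, of j i] by (simp add: \<Lambda>_g)
  show ?thesis
    by (subst (1 2) matrix_theta_expand) (simp add: mlinear_sum f mlinear_cscale *)
qed

definition twist :: "complex^'n^'n \<Rightarrow> complex^'n^'n" where
  "twist b = R (- (1/2)) ** b ** R (1/2)"

lemma twist_eq: "modular Q (\<i> / 2) b = twist b"
  by (simp add: modular_def twist_def)

text \<open>In the coordinates \<open>opvec\<close>, \<open>Emat A\<close> is the operator \<open>T \<mapsto> a\<^sup>* T \<sigma>\<^bsub>i/2\<^esub>(b)\<close> when
  \<open>A = \<theta>\<^bsub>\<Lambda>(a),\<Lambda>(b)\<^esub>\<close>.\<close>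

definition Emat :: "complex^'m^'m \<Rightarrow> complex^('n \<times> 'n)^('n \<times> 'n)" where
  "Emat A = op_action (Psi B \<Lambda> Q A)"

lemma Emat_theta:
  assumes "a \<in> B" "b \<in> B"
  shows "Emat (theta (\<Lambda> a) (\<Lambda> b)) = kron (cadj a) (transpose (twist b))"
  unfolding Emat_def Psi_theta[OF B gns assms] op_action_kron twist_eq ..

lemma mlinear_Emat [mlinear_intros]: "mlinear f \<Longrightarrow> mlinear (\<lambda>X. Emat (f X))"
  by (simp add: mlinear_def Emat_def)
    (simp add: Psi_def op_action_def cscale_def vec_eq_iff algebra_simps sum.distrib sum_distrib_left)

abbreviation m :: "complex^('m \<times> 'm)^'m" where "m \<equiv> gns_mult B \<Lambda>"

lemma m_vtensor: "a \<in> B \<Longrightarrow> b \<in> B \<Longrightarrow> m *v vtensor (\<Lambda> a) (\<Lambda> b) = \<Lambda> (a ** b)"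
  using gns_mult_vtensor[OF B gns] by simp

definition schur :: "complex^'m^'m \<Rightarrow> complex^'m^'m \<Rightarrow> complex^'m^'m" where
  "schur A A' = m ** kron A A' ** cadj m"

lemma schur_theta:
  assumes "a \<in> B" "b \<in> B" "c \<in> B" "d \<in> B"
  shows "schur (theta (\<Lambda> a) (\<Lambda> b)) (theta (\<Lambda> c) (\<Lambda> d)) = theta (\<Lambda> (a ** c)) (\<Lambda> (b ** d))"
  using assms
  by (simp add: schur_def kron_theta matrix_mult_theta theta_mult_matrix m_vtensor)

lemma twist_mult: "twist a ** twist b = twist (a ** b)"
  by (simp add: twist_def R_mult R_mult_assoc R_zero flip: matrix_mul_assoc)

text \<open>The order is reversed in both tensor factors at once: by the adjoint in the first, and
  by the transposition in the second.\<close>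

lemma Emat_schur: "Emat (schur A A') = Emat A' ** Emat A"
proof (rule theta_ext[of "\<lambda>A. Emat (schur A A')"])
  fix a b assume ab: "a \<in> B" "b \<in> B"
  show "Emat (schur (theta (\<Lambda> a) (\<Lambda> b)) A') = Emat A' ** Emat (theta (\<Lambda> a) (\<Lambda> b))"
  proof (rule theta_ext[of "\<lambda>A'. Emat (schur (theta (\<Lambda> a) (\<Lambda> b)) A')"])
    fix c d assume "c \<in> B" "d \<in> B"
    then show "Emat (schur (theta (\<Lambda> a) (\<Lambda> b)) (theta (\<Lambda> c) (\<Lambda> d)))
      = Emat (theta (\<Lambda> c) (\<Lambda> d)) ** Emat (theta (\<Lambda> a) (\<Lambda> b))"
      using ab by (simp add: schur_theta Emat_theta B_closed kron_mult cadj_mult twist_mult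
          flip: transpose_mult)
  qed (simp_all add: schur_def mlinear_intros)
qed (simp_all add: schur_def mlinear_intros)

definition Jop :: "complex^'m^'m \<Rightarrow> complex^'m^'m" where
  "Jop A = runit_op ** kron (mat 1) (cadj (gns_unit \<Lambda>) ** m) ** kron (mat 1) (kron A (mat 1))
     ** assoc_op ** kron (cadj m ** gns_unit \<Lambda>) (mat 1) ** lunit_op"

lemma contract_right_unit:
  assumes a: "a \<in> B"
  shows "contract_right (\<Lambda> a) (cadj m *v \<Lambda> (mat 1)) = \<Lambda> (Q ** cadj a ** R (- 1))"
proof (rule cinner_ext)
  fix w obtain x where x: "x \<in> B" "w = \<Lambda> x" by (rule \<Lambda>_surj)
  have "cinner w (contract_right (\<Lambda> a) (cadj m *v \<Lambda> (mat 1))) = tr (Q ** (cadj a ** cadj x))"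
    using a x by (simp add: cinner_contract_right cinner_cadj_right m_vtensor \<Lambda>_inner B_closed
        state cadj_mult)
  also have "\<dots> = tr (cadj x ** (Q ** cadj a))"
    using a x tracial[of "Q ** cadj a" "cadj x"] by (simp add: B_closed matrix_mul_assoc)
  \<comment> \<open>Inserting \<open>R (- 1) ** Q\<close> and moving \<open>R (- 1)\<close> to the
    end restores the factor \<open>Q\<close> in front of \<open>cadj x\<close>, so that
    \<open>\<psi>\<close> reappears.\<close>
  also have "\<dots> = tr (R (- 1) ** (Q ** cadj x ** Q ** cadj a))"
    by (simp add: Q_mult R_zero flip: matrix_mul_assoc)
  also have "\<dots> = tr (Q ** cadj x ** Q ** cadj a ** R (- 1))"
    using a x by (intro tracial B_closed)
  also have "\<dots> = cinner w (\<Lambda> (Q ** cadj a ** R (- 1)))"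
    using a x by (simp add: \<Lambda>_inner B_closed state matrix_mul_assoc)
  finally show "cinner w (contract_right (\<Lambda> a) (cadj m *v \<Lambda> (mat 1)))
    = cinner w (\<Lambda> (Q ** cadj a ** R (- 1)))" .
qed

lemma gns_unit_apply: "gns_unit \<Lambda> *v vec 1 = \<Lambda> (mat 1)"
  by (simp add: gns_unit_def matrix_vector_mult_def vec_eq_iff)

lemma cadj_gns_unit_apply: "(cadj (gns_unit \<Lambda>) *v v) $ 1 = cinner (\<Lambda> (mat 1)) v"
  by (simp add: gns_unit_def cadj_def matrix_vector_mult_def cinner_def)

text \<open>The unit and \<open>m\<close> at one end pair \<open>b\<close> with the argument
  \<open>z\<close> to give \<open>\<psi> (b ** z)\<close>, the inner product of
  \<open>\<Lambda> (cadj b)\<close> with \<open>\<Lambda> z\<close>; the contraction at the other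
  end is \<open>contract_right_unit\<close>.\<close>

lemma Jop_theta:
  assumes ab: "a \<in> B" "b \<in> B"
  shows "Jop (theta (\<Lambda> a) (\<Lambda> b)) = theta (\<Lambda> (cadj b)) (\<Lambda> (Q ** cadj a ** R (- 1)))"
proof (rule matrix_ext)
  fix v obtain z where z: "z \<in> B" "v = \<Lambda> z" by (rule \<Lambda>_surj)
  have "Jop (theta (\<Lambda> a) (\<Lambda> b)) *v v
      = cinner (\<Lambda> (mat 1)) (\<Lambda> (b ** z)) *s contract_right (\<Lambda> a) (cadj m *v \<Lambda> (mat 1))"
    unfolding Jop_def
    by (simp only: matrix_vector_mul_assoc[symmetric] lunit_op_apply kron_vtensor
        matrix_vector_mul_lid gns_unit_apply kron_mat_1_theta_assoc runit_op_vtensor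
        cadj_gns_unit_apply z m_vtensor ab)
  also have "\<dots> = theta (\<Lambda> (cadj b)) (\<Lambda> (Q ** cadj a ** R (- 1))) *v v"
    using ab z by (simp add: contract_right_unit theta_apply \<Lambda>_inner B_closed)
  finally show "Jop (theta (\<Lambda> a) (\<Lambda> b)) *v v = \<dots>" .
qed

lemma mlinear_Jop [mlinear_intros]: "mlinear f \<Longrightarrow> mlinear (\<lambda>X. Jop (f X))"
  unfolding Jop_def by (intro mlinear_intros)

text \<open>The conjugation by \<open>Q\<close> in \<open>Jop_theta\<close> is what turns
  \<open>twist\<close> into its adjoint. For self-adjoint \<open>A\<close> with
  \<open>Jop A = A\<close> it follows that \<open>Emat A\<close> is Hermitian.\<close>

lemma Emat_Jop: "Emat (Jop A) = cadj (Emat (cadj A))"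
proof (rule theta_ext[of "\<lambda>A. Emat (Jop A)" "\<lambda>A. cadj (Emat (cadj A))"])
  fix a b assume ab: "a \<in> B" "b \<in> B"
  have "twist (Q ** cadj a ** R (- 1)) = cadj (twist a)"
    by (simp add: twist_def cadj_mult cadj_R_half Q_mult R_mult flip: matrix_mul_assoc)
  then show "Emat (Jop (theta (\<Lambda> a) (\<Lambda> b))) = cadj (Emat (cadj (theta (\<Lambda> a) (\<Lambda> b))))"
    using ab by (simp add: Jop_theta Emat_theta B_closed cadj_theta cadj_kron transpose_cadj)
qed (intro mlinear_intros)+

text \<open>In the coordinates \<open>opvec\<close>, conjugation by the power \<open>-1/2\<close> of
  \<open>Q\<close>, with inverse \<open>D'\<close>.\<close>

abbreviation D :: "complex^('n \<times> 'n)^('n \<times> 'n)" where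
  "D \<equiv> kron (R (- (1/2))) (transpose (R (1/2)))"
abbreviation D' :: "complex^('n \<times> 'n)^('n \<times> 'n)" where
  "D' \<equiv> kron (R (1/2)) (transpose (R (- (1/2))))"

text \<open>Taking the adjoint of \<open>A\<close> exchanges \<open>a\<close> and \<open>b\<close>,
  and \<open>swapconj\<close> exchanges the two legs back; \<open>D\<close> and \<open>D'\<close>
  then move the twist to the correct leg.\<close>

lemma Emat_cadj: "Emat (cadj A) = D ** swapconj (Emat A) ** D'"
proof -
  \<comment> \<open>For \<open>C = cadj A\<close> both sides are linear in \<open>C\<close>, as
    \<open>theta_ext\<close> requires, whereas they are conjugate-linear in
    \<open>A\<close>.\<close>
  have "Emat C = D ** swapconj (Emat (cadj C)) ** D'" for C
  proof (rule theta_ext[of Emat "\<lambda>C. D ** swapconj (Emat (cadj C)) ** D'"])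
    fix a b assume ab: "a \<in> B" "b \<in> B"
    show "Emat (theta (\<Lambda> a) (\<Lambda> b)) = D ** swapconj (Emat (cadj (theta (\<Lambda> a) (\<Lambda> b)))) ** D'"
      using ab
      by (simp add: cadj_theta Emat_theta swapconj_kron kron_mult twist_def cadj_mult cadj_R_half
          R_mult R_mult_assoc R_zero transpose_mult[symmetric] flip: matrix_mul_assoc)
  qed (intro mlinear_intros)+
  from this[of "cadj A"] show ?thesis by simp
qed

definition degree_op :: "complex^'m^'m \<Rightarrow> complex^'m^'m" where
  "degree_op A = m ** kron A (mat 1) ** cadj m"

lemma degree_op_theta:
  assumes "a \<in> B" "b \<in> B" "z \<in> B"
  shows "degree_op (theta (\<Lambda> a) (\<Lambda> b)) *v \<Lambda> z = \<Lambda> (b ** cadj a ** z)"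
proof -
  have "contract_left (\<Lambda> a) (cadj m *v \<Lambda> z) = \<Lambda> (cadj a ** z)"
  proof (rule cinner_ext)
    fix w obtain x where x: "x \<in> B" "w = \<Lambda> x" by (rule \<Lambda>_surj)
    then show "cinner w (contract_left (\<Lambda> a) (cadj m *v \<Lambda> z)) = cinner w (\<Lambda> (cadj a ** z))"
      using assms by (simp add: cinner_contract_left cinner_cadj_right m_vtensor \<Lambda>_inner B_closed
          cadj_mult matrix_mul_assoc)
  qed
  then show ?thesis
    using assms by (simp add: degree_op_def kron_theta_mat_1 m_vtensor B_closed matrix_mul_assoc
        flip: matrix_vector_mul_assoc)
qed

text \<open>\<open>degree_op\<close> multiplies by \<open>b ** cadj a\<close>, whereas
  \<open>Emat\<close> has \<open>cadj a\<close> on the left. Applying \<open>Jop\<close> first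
  reverses this order, and the powers of \<open>Q\<close> account for the twist.\<close>

lemma degree_op_Jop:
  assumes z: "z \<in> B"
  shows "\<Lambda>inv (degree_op (Jop A) *v \<Lambda> z)
    = Q ** unopvec (Emat A *v opvec (R (- (1/2)))) ** (R (- (1/2)) ** z)"
proof (rule theta_ext[of "\<lambda>A. \<Lambda>inv (degree_op (Jop A) *v \<Lambda> z)"
      "\<lambda>A. Q ** unopvec (Emat A *v opvec (R (- (1/2)))) ** (R (- (1/2)) ** z)"])
  fix a b assume ab: "a \<in> B" "b \<in> B"
  have "\<Lambda>inv (degree_op (Jop (theta (\<Lambda> a) (\<Lambda> b))) *v \<Lambda> z) = Q ** cadj a ** R (- 1) ** b ** z"
    using ab z by (simp add: Jop_theta degree_op_theta B_closed \<Lambda>inv_\<Lambda>)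
  also have "\<dots> = Q ** unopvec (Emat (theta (\<Lambda> a) (\<Lambda> b)) *v opvec (R (- (1/2)))) ** (R (- (1/2)) ** z)"
    using ab by (simp add: Emat_theta kron_opvec twist_def R_mult R_mult_assoc R_zero
        flip: matrix_mul_assoc)
  finally show "\<Lambda>inv (degree_op (Jop (theta (\<Lambda> a) (\<Lambda> b))) *v \<Lambda> z) = \<dots>" .
qed (unfold degree_op_def, (intro mlinear_intros)+)

text \<open>By \<open>degree_op_Jop\<close>, with \<open>U\<close> the image of
  \<open>R (- (1/2))\<close> under \<open>Emat A\<close>, \<open>degree_op A\<close> is left
  multiplication by \<open>Q ** U ** R (- (1/2))\<close>, which is the identity exactly if
  \<open>U = R (- (1/2))\<close>.\<close>

lemma degree_op_eq_1_iff:
  assumes "Jop A = A"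
  shows "degree_op A = mat 1 \<longleftrightarrow> Emat A *v opvec (R (- (1/2))) = opvec (R (- (1/2)))"
proof
  assume "degree_op A = mat 1"
  define U where "U = unopvec (Emat A *v opvec (R (- (1/2))))"
  have "mat 1 = Q ** U ** R (- (1/2))"
    using degree_op_Jop[OF B_one, of A] assms \<open>degree_op A = mat 1\<close>
    by (simp add: \<Lambda>inv_\<Lambda> B_one U_def)
  then have "R (- 1) ** mat 1 ** R (1/2) = R (- 1) ** (Q ** U ** R (- (1/2))) ** R (1/2)" by simp
  then have "R (- (1/2)) = U"
    by (simp add: Q_mult R_mult R_mult_assoc R_zero flip: matrix_mul_assoc)
  then have "opvec U = opvec (R (- (1/2)))" by simp
  then show "Emat A *v opvec (R (- (1/2))) = opvec (R (- (1/2)))" by (simp add: U_def)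
next
  assume E: "Emat A *v opvec (R (- (1/2))) = opvec (R (- (1/2)))"
  show "degree_op A = mat 1"
  proof (rule matrix_ext)
    fix v obtain z where z: "z \<in> B" "v = \<Lambda> z" by (rule \<Lambda>_surj)
    have "\<Lambda>inv (degree_op A *v v) = Q ** R (- (1/2)) ** (R (- (1/2)) ** z)"
      using degree_op_Jop[OF z(1), of A] assms E z(2) by simp
    also have "\<dots> = z" by (simp add: Q_mult R_mult_assoc R_zero flip: matrix_mul_assoc)
    finally show "degree_op A *v v = mat 1 *v v" using z by (metis \<Lambda>_\<Lambda>inv matrix_vector_mul_lid)
  qed
qed

lemma quantum_adjacency_iff:
  "quantum_adjacency B \<Lambda> A \<longleftrightarrow> cadj A = A \<and> schur A A = A \<and> Jop A = A \<and> degree_op A = mat 1"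
  by (simp add: quantum_adjacency_def Let_def schur_def Jop_def degree_op_def)

lemma twist_commutant: "x \<in> commutant B \<Longrightarrow> b \<in> B \<Longrightarrow> x ** twist b = twist b ** x"
  by (simp add: commutant_def twist_def B_closed)

lemma Emat_commute_left:
  assumes x: "x \<in> commutant B"
  shows "kron x (mat 1) ** Emat A = Emat A ** kron x (mat 1)"
proof (rule theta_ext[of "\<lambda>A. kron x (mat 1) ** Emat A" "\<lambda>A. Emat A ** kron x (mat 1)"])
  fix a b assume ab: "a \<in> B" "b \<in> B"
  then show "kron x (mat 1) ** Emat (theta (\<Lambda> a) (\<Lambda> b)) = Emat (theta (\<Lambda> a) (\<Lambda> b)) ** kron x (mat 1)"
    using x by (simp add: Emat_theta kron_mult commutant_def B_closed)
qed (intro mlinear_intros)+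

lemma Emat_commute_right:
  assumes x: "x \<in> commutant B"
  shows "kron (mat 1) (transpose x) ** Emat A = Emat A ** kron (mat 1) (transpose x)"
proof (rule theta_ext[of "\<lambda>A. kron (mat 1) (transpose x) ** Emat A"
      "\<lambda>A. Emat A ** kron (mat 1) (transpose x)"])
  fix a b assume ab: "a \<in> B" "b \<in> B"
  then show "kron (mat 1) (transpose x) ** Emat (theta (\<Lambda> a) (\<Lambda> b))
      = Emat (theta (\<Lambda> a) (\<Lambda> b)) ** kron (mat 1) (transpose x)"
    using twist_commutant[OF x] by (simp add: Emat_theta kron_mult flip: transpose_mult)
qed (intro mlinear_intros)+

lemma mlinear_twist [mlinear_intros]: "mlinear f \<Longrightarrow> mlinear (\<lambda>X. twist (f X))"
  unfolding twist_def by (intro mlinear_intros)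

text \<open>The columns of \<open>A\<close> are the coefficients with respect to the basis
  \<open>cadj (g j)\<close> in the first leg; injectivity and surjectivity of \<open>Emat\<close>
  are read off from this form.\<close>

lemma Emat_expand: "Emat A = (\<Sum>j\<in>UNIV. kron (cadj (g j)) (transpose (twist (\<Lambda>inv (column j A)))))"
proof -
  have "op_action (\<Sum>j\<in>F. h j) = (\<Sum>j\<in>F. op_action (h j))" for h :: "'m \<Rightarrow> complex^('n \<times> 'n)^('n \<times> 'n)" and F
    by (rule mlinear_sum) (simp add: mlinear_def op_action_add op_action_cscale)
  then have "Emat A = (\<Sum>i\<in>UNIV. \<Sum>j\<in>UNIV. cscale (A $ i $ j) (kron (cadj (g j)) (transpose (twist (g i)))))"
    by (simp add: Emat_def Psi_def twist_eq op_action_cscale op_action_kron)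
  also have "\<dots> = (\<Sum>j\<in>UNIV. \<Sum>i\<in>UNIV. cscale (A $ i $ j) (kron (cadj (g j)) (transpose (twist (g i)))))"
    by (rule sum.swap)
  also have "\<dots> = (\<Sum>j\<in>UNIV. kron (cadj (g j)) (transpose (twist (\<Lambda>inv (column j A)))))"
  proof (intro sum.cong refl)
    fix j
    have lin: "mlinear (\<lambda>b. kron (cadj (g j)) (transpose (twist b)))" by (intro mlinear_intros)
    show "(\<Sum>i\<in>UNIV. cscale (A $ i $ j) (kron (cadj (g j)) (transpose (twist (g i)))))
      = kron (cadj (g j)) (transpose (twist (\<Lambda>inv (column j A))))"
      by (simp add: \<Lambda>inv_def column_def mlinear_sum[OF lin] mlinear_cscale[OF lin])
  qed
  finally show ?thesis .
qed

lemma slice_sum_kron: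
  "slice (\<Sum>j\<in>UNIV. kron (cadj (g j)) (Z j)) p q = cadj (\<Lambda>inv (\<chi> j. cnj (Z j $ p $ q)))"
  by (simp add: slice_def kron_def cadj_def \<Lambda>inv_def cscale_def vec_eq_iff mult.commute)

lemma kron_expand_unique:
  assumes "(\<Sum>j\<in>UNIV. kron (cadj (g j)) (Z j)) = (\<Sum>j\<in>UNIV. kron (cadj (g j)) (Z' j))"
  shows "Z = Z'"
proof -
  have "cadj (\<Lambda>inv (\<chi> j. cnj (Z j $ p $ q))) = cadj (\<Lambda>inv (\<chi> j. cnj (Z' j $ p $ q)))" for p q
    using assms by (simp flip: slice_sum_kron)
  then have "(\<chi> j. cnj (Z j $ p $ q)) = (\<chi> j. cnj (Z' j $ p $ q))" for p q
    by (metis \<Lambda>_\<Lambda>inv cadj_eq_iff)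
  then show ?thesis by (simp add: vec_eq_iff fun_eq_iff)
qed

lemma twist_inverse: "R (1/2) ** twist b ** R (- (1/2)) = b"
  "twist (R (1/2) ** b ** R (- (1/2))) = b"
  by (simp_all add: twist_def R_mult R_mult_assoc R_zero flip: matrix_mul_assoc)

lemma Emat_inj:
  assumes "Emat A = Emat A'" shows "A = A'"
proof -
  have "transpose (twist (\<Lambda>inv (column j A))) = transpose (twist (\<Lambda>inv (column j A')))" for j
    using kron_expand_unique[OF assms[unfolded Emat_expand]] by metis
  then have "column j A = column j A'" for j
    by (metis \<Lambda>_\<Lambda>inv transpose_transpose twist_inverse(1))
  then show ?thesis by (simp add: column_def vec_eq_iff)
qed

text \<open>\<open>(B \<otimes> \<B>(H)) \<inter> (\<B>(H) \<otimes> B) = B \<otimes> B\<close>, by comparing coefficients with respect to a basis of \<open>B\<close>.\<close>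

lemma Emat_surj:
  assumes left: "\<And>x. x \<in> commutant B \<Longrightarrow> kron x (mat 1) ** E = E ** kron x (mat 1)"
    and right: "\<And>x. x \<in> commutant B \<Longrightarrow>
      kron (mat 1) (transpose x) ** E = E ** kron (mat 1) (transpose x)"
  obtains A where "Emat A = E"
proof -
  have slices: "slice E p q \<in> B" for p q
    unfolding commutant_iff using left kron_commute_iff[of _ E] by blast
  \<comment> \<open>\<open>Z j $ p $ q\<close> is the coefficient of \<open>cadj (g j)\<close> in
    \<open>slice E p q\<close>; the conjugations arise because the adjoint of the slice is expanded
    in the \<open>g j\<close>.\<close>
  define Z where "Z j = (\<chi> p q. cnj (\<Lambda> (cadj (slice E p q)) $ j))" for j
  have E: "E = (\<Sum>j\<in>UNIV. kron (cadj (g j)) (Z j))"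
  proof (rule slice_eqI)
    fix p q
    have "(\<chi> j. cnj (Z j $ p $ q)) = \<Lambda> (cadj (slice E p q))" by (simp add: Z_def vec_eq_iff)
    then show "slice E p q = slice (\<Sum>j\<in>UNIV. kron (cadj (g j)) (Z j)) p q"
      by (simp add: slice_sum_kron \<Lambda>inv_\<Lambda> B_cadj slices)
  qed
  have "transpose (Z j) \<in> B" for j
    unfolding commutant_iff
  proof
    fix x assume x: "x \<in> commutant B"
    have "(\<Sum>j\<in>UNIV. kron (cadj (g j)) (transpose x ** Z j)) = (\<Sum>j\<in>UNIV. kron (cadj (g j)) (Z j ** transpose x))"
      using right[OF x] by (simp add: E matrix_mult_sum sum_matrix_mult kron_mult)
    from kron_expand_unique[OF this] have "transpose x ** Z j = Z j ** transpose x" by metis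
    then have "transpose (transpose x ** Z j) = transpose (Z j ** transpose x)" by simp
    then show "x ** transpose (Z j) = transpose (Z j) ** x" by (simp add: transpose_mult)
  qed
  then have c: "R (1/2) ** transpose (Z j) ** R (- (1/2)) \<in> B" for j by (simp add: B_closed)
  \<comment> \<open>Conjugation by \<open>R (1/2)\<close> inverts \<open>twist\<close>, so column
    \<open>j\<close> produces \<open>transpose (Z j)\<close> after twisting.\<close>
  define A where "A = (\<chi> i j. \<Lambda> (R (1/2) ** transpose (Z j) ** R (- (1/2))) $ i)"
  have "column j A = \<Lambda> (R (1/2) ** transpose (Z j) ** R (- (1/2)))" for j
    by (simp add: column_def A_def vec_eq_iff)
  then have "Emat A = E"
    unfolding Emat_expand by (simp add: \<Lambda>inv_\<Lambda> c twist_inverse E)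
  then show thesis by (rule that)
qed

end

section \<open>Bimodules\<close>

definition adop :: "complex^'n^'n \<Rightarrow> complex \<Rightarrow> complex^('n \<times> 'n)^('n \<times> 'n)" where
  "adop X w = kron (mpow X w) (transpose (mpow X (- w)))"

lemma adop_opvec: "adop X w *v opvec T = opvec (mpow X w ** T ** mpow X (- w))"
  by (simp add: adop_def kron_opvec)

lemma commute_mult:
  fixes X Y Z :: "complex^'k^'k"
  assumes "X ** Y = Y ** X" "X ** Z = Z ** X"
  shows "X ** (Y ** Z) = (Y ** Z) ** X"
proof -
  have "X ** (Y ** Z) = Y ** (X ** Z)" by (simp add: matrix_mul_assoc assms(1))
  then show ?thesis by (simp add: matrix_mul_assoc assms(2))
qed

lemma commute_inverse:
  fixes X Y Y' :: "complex^'k^'k"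
  assumes "X ** Y = Y ** X" "Y ** Y' = mat 1" "Y' ** Y = mat 1"
  shows "X ** Y' = Y' ** X"
proof -
  have "Y' ** (X ** Y) ** Y' = Y' ** (Y ** X) ** Y'" using assms(1) by simp
  then have "Y' ** X ** (Y ** Y') = (Y' ** Y) ** X ** Y'" by (simp add: matrix_mul_assoc)
  then show ?thesis by (simp add: assms)
qed

lemma subspace_image_mult:
  "cmat.subspace S \<Longrightarrow> cmat.subspace ((\<lambda>s. (M :: complex^'n^'k) ** (s :: complex^'l^'n)) ` S)"
  unfolding cmat.subspace_def
proof (elim conjE, intro conjI ballI allI)
  assume S: "0 \<in> S" "\<forall>x\<in>S. \<forall>y\<in>S. x + y \<in> S" "\<forall>c. \<forall>x\<in>S. cscale c x \<in> S"
  show "0 \<in> (\<lambda>s. M ** s) ` S"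
    using S(1) by (intro image_eqI[of _ _ 0]) (simp_all add: matrix_matrix_mult_def vec_eq_iff)
  show "x + y \<in> (\<lambda>s. M ** s) ` S" if "x \<in> (\<lambda>s. M ** s) ` S" "y \<in> (\<lambda>s. M ** s) ` S" for x y
    using that S(2) by (auto simp flip: matrix_add_ldistrib)
  show "cscale c x \<in> (\<lambda>s. M ** s) ` S" if "x \<in> (\<lambda>s. M ** s) ` S" for c x
    using that S(3) by (auto simp flip: cscale_mult_right)
qed

context
  fixes X :: "complex^'n^'n"
  assumes X: "positive_op X" "invertible X"
begin

lemma mpow_mult: "mpow X w ** mpow X z = mpow X (w + z)"
  and mpow_mult_assoc: "mpow X w ** (mpow X z ** Y) = mpow X (w + z) ** Y"
  by (simp_all add: mpow_add[OF X] matrix_mul_assoc)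

lemma adop_mult: "adop X w ** adop X z = adop X (w + z)"
  by (simp add: adop_def kron_mult mpow_mult add.commute flip: transpose_mult)

lemma adop_zero: "adop X 0 = mat 1"
  by (simp add: adop_def mpow_zero[OF X] kron_mat_1 transpose_mat)

lemma cadj_adop: "cnj w = w \<Longrightarrow> cadj (adop X w) = adop X w"
  by (simp add: adop_def cadj_kron transpose_cadj cadj_mpow[OF X])

text \<open>\<open>adop X (1/2)\<close> is a positive square root of \<open>adop X 1\<close>, its
  own root being \<open>adop X (1/4)\<close>, so \<open>commute_positive_root\<close>
  applies.\<close>

lemma commute_adop_half:
  assumes comm: "E ** adop X 1 = adop X 1 ** E" and w: "w \<in> {1/2, - (1/2)}"
  shows "E ** adop X w = adop X w ** E"
proof -
  have "E ** adop X (1/2) = adop X (1/2) ** E"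
  proof (rule commute_positive_root)
    show "adop X (1/2) = cadj (adop X (1/4)) ** adop X (1/4)"
      by (simp add: cadj_adop adop_mult)
    show "invertible (adop X (1/4))"
      unfolding invertible_def by (rule exI[of _ "adop X (- (1/4))"]) (simp add: adop_mult adop_zero)
    show "E ** (adop X (1/2) ** adop X (1/2)) = adop X (1/2) ** adop X (1/2) ** E"
      using comm by (simp add: adop_mult)
  qed
  moreover from this have "E ** adop X (- (1/2)) = adop X (- (1/2)) ** E"
    by (rule commute_inverse) (simp_all add: adop_mult adop_zero)
  ultimately show ?thesis using w unfolding insert_iff empty_iff by metis
qed

text \<open>\<open>adop X 1\<close> is Hermitian, so invariance of \<open>S\<close> under it alone
  makes it commute with \<open>P\<close>; the half powers then commute as well.\<close>

lemma orth_proj_adop_commute: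
  assumes P: "orth_proj P (opvec ` S)" and S: "\<And>s. s \<in> S \<Longrightarrow> X ** s ** mpow X (- 1) \<in> S"
    and w: "w \<in> {1/2, - (1/2)}"
  shows "P ** adop X w = adop X w ** P"
proof (rule commute_adop_half[OF _ w])
  have inv: "adop X 1 *v v \<in> opvec ` S" if "v \<in> opvec ` S" for v
    using that S by (auto simp: adop_opvec mpow_one[OF X])
  show "P ** adop X 1 = adop X 1 ** P"
    by (rule orth_proj_commute[OF P]) (simp_all add: cadj_adop inv)
qed

lemma conj_mpow_half_in:
  assumes "cmat.subspace S" and S: "\<And>s. s \<in> S \<Longrightarrow> X ** s ** mpow X (- 1) \<in> S"
    and w: "w \<in> {1/2, - (1/2)}" and s: "s \<in> S"
  shows "mpow X w ** s ** mpow X (- w) \<in> S"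
proof -
  obtain P where P: "orth_proj P (opvec ` S)"
    using orth_proj_exists[OF subspace_opvec[OF assms(1)]] by blast
  have "P *v opvec s = opvec s" using P s by (simp add: orth_proj_def)
  then have "adop X w *v opvec s = P *v (adop X w *v opvec s)"
    using orth_proj_adop_commute[OF P S w] by (metis matrix_vector_mul_assoc)
  also have "\<dots> \<in> opvec ` S" using P by (simp add: orth_proj_def)
  finally show ?thesis by (auto simp: adop_opvec)
qed

lemma image_mpow_mult:
  fixes S :: "(complex^'l^'n) set"
  shows "(\<lambda>s. mpow X w ** s) ` (\<lambda>s. mpow X z ** s) ` S = (\<lambda>s. mpow X (w + z) ** s) ` S"
  by (simp add: image_image mpow_mult_assoc)

lemma conj_inv_image:
  assumes S: "(\<lambda>s. X ** s ** mpow X (- 1)) ` S = S"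
  shows "(\<lambda>s. X ** s ** mpow X (- 1)) ` (\<lambda>s. mpow X w ** s) ` S = (\<lambda>s. mpow X w ** s) ` S"
proof -
  have "X ** (mpow X w ** s) ** mpow X (- 1) = mpow X w ** (X ** s ** mpow X (- 1))" for s
    using mpow_commute[OF X refl, of w] by (metis matrix_mul_assoc)
  then have "(\<lambda>s. X ** s ** mpow X (- 1)) ` (\<lambda>s. mpow X w ** s) ` S
      = (\<lambda>s. mpow X w ** s) ` (\<lambda>s. X ** s ** mpow X (- 1)) ` S"
    by (simp add: image_image)
  then show ?thesis by (simp add: S)
qed

text \<open>As \<open>S\<close> is invariant under conjugation by \<open>X\<^sup>w\<close>, \<open>X\<^sup>w S = S X\<^sup>w\<close>, which is self-adjoint.\<close>

lemma self_adjoint_bimodule_image: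
  assumes S: "self_adjoint_bimodule C S" "(\<lambda>s. X ** s ** mpow X (- 1)) ` S = S"
    and w: "w \<in> {1/2, - (1/2)}"
    and C: "\<And>x. x \<in> C \<Longrightarrow> mpow X (- w) ** x ** mpow X w \<in> C"
  shows "self_adjoint_bimodule C ((\<lambda>s. mpow X w ** s) ` S)"
proof -
  have sub: "cmat.subspace S" and bim: "\<And>x y s. x \<in> C \<Longrightarrow> y \<in> C \<Longrightarrow> s \<in> S \<Longrightarrow> x ** s ** y \<in> S"
    and adj: "\<And>s. s \<in> S \<Longrightarrow> cadj s \<in> S"
    using S(1) by (auto simp: self_adjoint_bimodule_def bimodule_def)
  let ?S = "(\<lambda>s. mpow X w ** s) ` S"
  have "x ** (mpow X w ** s) ** y \<in> ?S" if "x \<in> C" "y \<in> C" "s \<in> S" for x y s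
  proof (rule image_eqI)
    show "mpow X (- w) ** x ** mpow X w ** s ** y \<in> S" using C bim that by blast
    show "x ** (mpow X w ** s) ** y = mpow X w ** (mpow X (- w) ** x ** mpow X w ** s ** y)"
      by (simp add: mpow_mult_assoc mpow_zero[OF X] flip: matrix_mul_assoc)
  qed
  moreover have star: "cadj t \<in> ?S" if t: "t \<in> ?S" for t
  proof -
    obtain s where s: "s \<in> S" "t = mpow X w ** s" using t by blast
    show ?thesis
    proof (rule image_eqI)
      have "- w \<in> {1/2, - (1/2)}" using w by auto
      moreover have "X ** s ** mpow X (- 1) \<in> S" if "s \<in> S" for s using that S(2) by blast
      ultimately show "mpow X (- w) ** cadj s ** mpow X w \<in> S"
        using conj_mpow_half_in[OF sub, of "- w" "cadj s"] adj s(1) by simp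
      have "cnj w = w" using w unfolding insert_iff empty_iff
        by (elim disjE) (simp_all only: complex_cnj_minus complex_cnj_divide complex_cnj_numeral complex_cnj_one)
      then have "cadj t = cadj s ** mpow X w" by (simp add: s(2) cadj_mult cadj_mpow[OF X])
      then show "cadj t = mpow X w ** (mpow X (- w) ** cadj s ** mpow X w)"
        by (simp add: mpow_mult_assoc mpow_zero[OF X] flip: matrix_mul_assoc)
    qed
  qed
  moreover have "cadj ` ?S = ?S"
  proof
    show "?S \<subseteq> cadj ` ?S"
    proof
      fix t assume "t \<in> ?S"
      then have "cadj t \<in> ?S" by (rule star)
      then show "t \<in> cadj ` ?S" by (metis cadj_cadj imageI)
    qed
  qed (use star in blast)
  ultimately show ?thesis
    using subspace_image_mult[OF sub] by (auto simp: self_adjoint_bimodule_def bimodule_def)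
qed

end

lemma bimodule_conj_image:
  assumes "bimodule C S" "x \<in> C" "x' \<in> C" "x ** x' = mat 1" "x' ** x = mat 1"
  shows "(\<lambda>s. x ** s ** x') ` S = S"
proof
  show "(\<lambda>s. x ** s ** x') ` S \<subseteq> S" using assms(1-3) by (auto simp: bimodule_def)
  show "S \<subseteq> (\<lambda>s. x ** s ** x') ` S"
  proof
    fix s assume "s \<in> S"
    then have "x' ** s ** x \<in> S" using assms(1-3) by (auto simp: bimodule_def)
    moreover have "x ** (x' ** s ** x) ** x' = (x ** x') ** s ** (x ** x')"
      by (simp add: matrix_mul_assoc)
    ultimately show "s \<in> (\<lambda>s. x ** s ** x') ` S"
      by (intro image_eqI[of _ _ "x' ** s ** x"]) (simp_all add: assms(4))
  qed
qed

section \<open>The correspondence between quantum adjacency matrices and bimodules, in terms of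
  \<open>Q\<close>\<close>

context gns_space
begin

lemma D_adop: "D = adop Q (- (1/2))" "D' = adop Q (1/2)"
  by (simp_all add: adop_def)

lemma associated_subspace_eq: "associated_subspace B \<Lambda> Q A = {T. opvec T \<in> range ((*v) (Emat A))}"
  by (simp add: associated_subspace_def Emat_def)

lemma commutant_one: "mat 1 \<in> commutant B"
  by (simp add: commutant_def)

text \<open>Here \<open>Emat A\<close> is an orthogonal projection and \<open>S\<close> its space of
  fixed points, so each property of \<open>S\<close> comes from an operator commuting with
  \<open>Emat A\<close>.\<close>

lemma associated_imp_bimodule:
  assumes A: "quantum_adjacency B \<Lambda> A" and S: "S = associated_subspace B \<Lambda> Q A"
  shows "self_adjoint_bimodule (commutant B) S \<and> (\<lambda>s. Q ** s ** R (- 1)) ` S = S \<and> R (- (1/2)) \<in> S"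
proof -
  let ?E = "Emat A"
  have A': "cadj A = A" "schur A A = A" "Jop A = A" "degree_op A = mat 1"
    using A by (simp_all add: quantum_adjacency_iff)
  have idem: "?E ** ?E = ?E" using Emat_schur[of A A] A'(2) by simp
  have herm: "cadj ?E = ?E" using Emat_Jop[of A] A'(1,3) by simp
  have mem: "T \<in> S \<longleftrightarrow> ?E *v opvec T = opvec T" for T
    unfolding S associated_subspace_eq mem_Collect_eq image_iff using idem
    by (metis UNIV_I matrix_vector_mul_assoc)
  note adop = D_adop adop_mult[OF Q(2,3)] adop_zero[OF Q(2,3)]
  have DD: "D ** D' = mat 1" "D' ** D = mat 1" by (simp_all only: adop) (simp_all add: adop)
  have E1: "?E = D ** swapconj ?E ** D'" using Emat_cadj[of A] A'(1) by simp
  have Dh: "cadj D = D" "cadj D' = D'" unfolding D_adop by (simp_all add: cadj_adop[OF Q(2,3)])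
  have "cadj ?E = cadj (D ** swapconj ?E ** D')" by (rule arg_cong[OF E1])
  then have E2: "?E = D' ** swapconj ?E ** D"
    by (simp only: cadj_mult cadj_swapconj herm Dh matrix_mul_assoc)
  \<comment> \<open>\<open>E1\<close> and its adjoint \<open>E2\<close> are solved for
    \<open>swapconj ?E\<close>. Comparison shows that \<open>?E\<close> commutes with
    \<open>D' ** D'\<close>, which is conjugation by \<open>Q\<close>.\<close>
  have "D' ** ?E ** D = D' ** (D ** swapconj ?E ** D') ** D" by (rule arg_cong[OF E1])
  also have "\<dots> = (D' ** D) ** swapconj ?E ** (D' ** D)" by (simp only: matrix_mul_assoc)
  finally have E3: "D' ** ?E ** D = swapconj ?E" by (simp add: DD)
  have "D ** ?E ** D' = D ** (D' ** swapconj ?E ** D) ** D'" by (rule arg_cong[OF E2])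
  also have "\<dots> = (D ** D') ** swapconj ?E ** (D ** D')" by (simp only: matrix_mul_assoc)
  finally have E4: "D ** ?E ** D' = swapconj ?E" by (simp add: DD)
  have "D' ** D' ** ?E = D' ** (D' ** ?E ** D) ** D'"
    by (simp only: matrix_mul_assoc[symmetric] DD matrix_mul_rid)
  also have "\<dots> = D' ** (D ** ?E ** D') ** D'" by (simp only: E3 E4)
  also have "\<dots> = (D' ** D) ** ?E ** D' ** D'" by (simp only: matrix_mul_assoc)
  finally have comm: "?E ** (D' ** D') = (D' ** D') ** ?E" by (simp add: DD matrix_mul_assoc)
  have comm1: "?E ** adop Q 1 = adop Q 1 ** ?E" using comm by (simp add: adop)
  \<comment> \<open>Once \<open>?E\<close> commutes with the root \<open>D'\<close>,
    \<open>E3\<close> collapses to \<open>swapconj ?E = ?E\<close>, which makes \<open>S\<close>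
    self-adjoint.\<close>
  have comm2: "?E ** D' = D' ** ?E"
    unfolding D_adop by (rule commute_adop_half[OF Q(2,3) comm1]) simp
  have "swapconj ?E = D' ** ?E ** D" by (rule E3[symmetric])
  also have "\<dots> = ?E ** (D' ** D)" by (simp only: comm2[symmetric] matrix_mul_assoc)
  finally have swap: "swapconj ?E = ?E" by (simp add: DD)
  have comm3: "?E ** adop Q (- 1) = adop Q (- 1) ** ?E"
    using comm1 by (rule commute_inverse) (simp_all add: adop)
  have sub: "cmat.subspace S"
    by (auto simp: cmat.subspace_def mem opvec_add opvec_cscale matrix_vector_right_distrib
        matrix_vector_scale) (simp add: opvec_def vec_eq_iff matrix_vector_mult_def)
  have bim: "x ** s ** y \<in> S" if "x \<in> commutant B" "y \<in> commutant B" "s \<in> S" for x y s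
  proof -
    have k: "kron x (transpose y) = kron x (mat 1) ** kron (mat 1) (transpose y)"
      by (simp add: kron_mult)
    have "?E ** kron x (transpose y) = kron x (transpose y) ** ?E"
      unfolding k using that
      by (intro commute_mult Emat_commute_left[symmetric] Emat_commute_right[symmetric])
    then have "?E *v (kron x (transpose y) *v opvec s) = kron x (transpose y) *v (?E *v opvec s)"
      by (simp add: matrix_vector_mul_assoc)
    then show ?thesis using that(3) by (simp add: mem kron_opvec)
  qed
  have star: "cadj s \<in> S" if "s \<in> S" for s
    using swapconj_opvec[of ?E s s] that by (simp add: mem swap)
  then have star': "cadj ` S = S" by (metis cadj_cadj image_iff subsetI subset_antisym)
  have conj: "R w ** s ** R (- w) \<in> S" if "s \<in> S" "w \<in> {1, - 1}" for s w
  proof -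
    have "?E ** adop Q w = adop Q w ** ?E" using comm1 comm3 that(2) by auto
    then have "?E *v (adop Q w *v opvec s) = adop Q w *v (?E *v opvec s)"
      by (simp add: matrix_vector_mul_assoc)
    then show ?thesis using that(1) by (simp add: mem adop_opvec)
  qed
  have "(\<lambda>s. Q ** s ** R (- 1)) ` S = S"
  proof
    show "(\<lambda>s. Q ** s ** R (- 1)) ` S \<subseteq> S" using conj[of _ 1] by (auto simp: R_one)
    show "S \<subseteq> (\<lambda>s. Q ** s ** R (- 1)) ` S"
    proof
      fix s assume "s \<in> S"
      then have "R (- 1) ** s ** Q \<in> S" using conj[of s "- 1"] by (simp add: R_one)
      moreover have "Q ** (R (- 1) ** s ** Q) ** R (- 1) = s"
        by (simp add: Q_mult R_zero flip: matrix_mul_assoc)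
      ultimately show "s \<in> (\<lambda>s. Q ** s ** R (- 1)) ` S" by force
    qed
  qed
  moreover have "R (- (1/2)) \<in> S" using degree_op_eq_1_iff[OF A'(3)] A'(4) by (simp add: mem)
  ultimately show ?thesis
    using sub bim star' by (simp add: self_adjoint_bimodule_def bimodule_def)
qed

text \<open>The projection onto \<open>S\<close> is \<open>Emat A\<close> for some \<open>A\<close>
  by \<open>Emat_surj\<close>; each condition on \<open>A\<close> is then checked on
  \<open>Emat A\<close>, using \<open>Emat_inj\<close> for those that are equations for
  \<open>A\<close>.\<close>

lemma bimodule_imp_associated:
  assumes S: "self_adjoint_bimodule (commutant B) S" "(\<lambda>s. Q ** s ** R (- 1)) ` S = S"
    "R (- (1/2)) \<in> S"
  shows "associated_to_quantum_adjacency B \<Lambda> Q S"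
proof -
  have sub: "cmat.subspace S"
    and bim: "\<And>x y s. x \<in> commutant B \<Longrightarrow> y \<in> commutant B \<Longrightarrow> s \<in> S \<Longrightarrow> x ** s ** y \<in> S"
    and adj: "\<And>s. s \<in> S \<Longrightarrow> cadj s \<in> S"
    using S(1) by (auto simp: self_adjoint_bimodule_def bimodule_def)
  have comm_adj: "cadj x \<in> commutant B" if "x \<in> commutant B" for x
    using commutant_star_subalgebra[OF B] that by (simp add: unital_star_subalgebra_def)
  obtain P where P: "orth_proj P (opvec ` S)"
    using orth_proj_exists[OF subspace_opvec[OF sub]] by blast
  have stable: "kron x (transpose y) *v v \<in> opvec ` S"
    if "x \<in> commutant B" "y \<in> commutant B" "v \<in> opvec ` S" for x y v
    using that bim by (auto simp: kron_opvec)
  have P_comm: "P ** kron x (transpose y) = kron x (transpose y) ** P"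
    if "x \<in> commutant B" "y \<in> commutant B" for x y
    by (rule orth_proj_commute[OF P])
      (use stable that comm_adj in \<open>auto simp: cadj_kron transpose_cadj\<close>)
  have "kron x (mat 1) ** P = P ** kron x (mat 1)" if "x \<in> commutant B" for x
    using P_comm[OF that commutant_one] by (simp add: transpose_mat)
  moreover have "kron (mat 1) (transpose x) ** P = P ** kron (mat 1) (transpose x)"
    if "x \<in> commutant B" for x
    using P_comm[OF commutant_one that] by simp
  ultimately obtain A where A: "Emat A = P" by (rule Emat_surj)
  \<comment> \<open>\<open>swapconj P\<close> projects onto the set of adjoints of \<open>S\<close>,
    which is \<open>S\<close> again, so uniqueness of projections applies.\<close>
  have "orth_proj (swapconj P) (opvec ` S)"
    unfolding orth_proj_def
  proof (intro conjI allI ballI)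
    show "cadj (swapconj P) = swapconj P" using P by (simp add: cadj_swapconj orth_proj_def)
  next
    fix v :: "complex^('n \<times> 'n)"
    obtain T :: "complex^'n^'n" where T: "v = opvec T" using opvec_surj by blast
    have "P *v opvec (cadj T) \<in> opvec ` S" using P by (simp add: orth_proj_def)
    then obtain U where U: "U \<in> S" "P *v opvec (cadj T) = opvec U" by blast
    from swapconj_opvec[OF U(2)] have "swapconj P *v v = opvec (cadj U)" by (simp add: T)
    then show "swapconj P *v v \<in> opvec ` S" using adj U(1) by simp
  next
    fix v assume "v \<in> opvec ` S"
    then obtain s where s: "s \<in> S" "v = opvec s" by blast
    have "P *v opvec (cadj s) = opvec (cadj s)" using P adj[OF s(1)] by (simp add: orth_proj_def)
    from swapconj_opvec[OF this] show "swapconj P *v v = v" by (simp add: s(2))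
  qed
  then have swap: "swapconj P = P" using P by (rule orth_proj_unique)
  have inv: "Q ** s ** R (- 1) \<in> S" if "s \<in> S" for s using that S(2) by blast
  \<comment> \<open>Commuting with \<open>D\<close> and invariance under \<open>swapconj\<close>
    make the right side of \<open>Emat_cadj\<close> equal to \<open>P\<close>, whence
    \<open>cadj A = A\<close>.\<close>
  have "P ** D = D ** P"
    unfolding D_adop by (rule orth_proj_adop_commute[OF Q(2,3) P inv]) simp_all
  then have "D ** P ** D' = P ** (D ** D')" by (simp add: matrix_mul_assoc)
  also have "D ** D' = mat 1" unfolding D_adop
    by (simp add: adop_mult[OF Q(2,3)] adop_zero[OF Q(2,3)])
  finally have "Emat (cadj A) = Emat A" by (simp add: Emat_cadj A swap)
  then have 1: "cadj A = A" by (rule Emat_inj)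
  have "Emat (Jop A) = Emat A" using P by (simp add: Emat_Jop 1 A orth_proj_def)
  then have 2: "Jop A = A" by (rule Emat_inj)
  have "Emat (schur A A) = Emat A" using orth_proj_idem[OF P] by (simp add: Emat_schur A)
  then have 3: "schur A A = A" by (rule Emat_inj)
  have 4: "degree_op A = mat 1"
    unfolding degree_op_eq_1_iff[OF 2] using P S(3) by (simp add: A orth_proj_def)
  have "S = associated_subspace B \<Lambda> Q A"
    unfolding associated_subspace_eq A orth_proj_range[OF P] by auto
  then show ?thesis
    unfolding associated_to_quantum_adjacency_def quantum_adjacency_iff using 1 2 3 4 by blast
qed

theorem associated_iff:
  "associated_to_quantum_adjacency B \<Lambda> Q S \<longleftrightarrow>
     self_adjoint_bimodule (commutant B) S \<and> (\<lambda>s. Q ** s ** R (- 1)) ` S = S \<and> R (- (1/2)) \<in> S"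
  using associated_imp_bimodule bimodule_imp_associated
  unfolding associated_to_quantum_adjacency_def by blast

end

section \<open>Passing from \<open>Q\<close> to the implementing operator \<open>q\<close>\<close>

locale implementing_operator = gns_space +
  fixes q
  assumes q: "positive_op q" "invertible q"
    and implements: "a \<in> B \<Longrightarrow> modular Q (of_real t) a = mpow q (\<i> * of_real t) ** a ** mpow q (- (\<i> * of_real t))"
begin

abbreviation r :: "complex \<Rightarrow> complex^'a^'a" where "r \<equiv> mpow q"

lemma conj_eq: "a \<in> B \<Longrightarrow> R w ** a ** R (- w) = r w ** a ** r (- w)"
  by (rule modular_analytic_continuation[OF Q(2,3) q]) (rule implements[unfolded modular_def])

lemma r_one: "r 1 = q" and r_zero: "r 0 = mat 1"
  using mpow_one[OF q] mpow_zero[OF q] by simp_all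

lemmas r_mult = mpow_mult[OF q] mpow_mult_assoc[OF q]

text \<open>Equal powers of \<open>Q\<close> and \<open>q\<close> conjugate \<open>B\<close> in the
  same way by \<open>conj_eq\<close>, so their quotients act trivially on \<open>B\<close>.\<close>

lemma quotient_commutant: "R (- w) ** r w \<in> commutant B" "r (- w) ** R w \<in> commutant B"
proof -
  have "R (- w) ** r w ** a = a ** (R (- w) ** r w) \<and> r (- w) ** R w ** a = a ** (r (- w) ** R w)"
    if a: "a \<in> B" for a
  proof
    have "R (- w) ** (r w ** a ** r (- w)) ** r w = R (- w) ** (R w ** a ** R (- w)) ** r w"
      using conj_eq[OF a, of w] by simp
    then show "R (- w) ** r w ** a = a ** (R (- w) ** r w)"
      by (simp add: R_mult_assoc R_zero r_mult r_zero flip: matrix_mul_assoc)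
    have "r (- w) ** (R w ** a ** R (- w)) ** R w = r (- w) ** (r w ** a ** r (- w)) ** R w"
      using conj_eq[OF a, of w] by simp
    then show "r (- w) ** R w ** a = a ** (r (- w) ** R w)"
      by (simp add: R_mult R_mult_assoc R_zero r_mult r_zero flip: matrix_mul_assoc)
  qed
  then show "R (- w) ** r w \<in> commutant B" "r (- w) ** R w \<in> commutant B"
    by (simp_all add: commutant_def)
qed

text \<open>As \<open>x\<close> commutes with \<open>R w\<close>, conjugating by powers of
  \<open>q\<close> is the same as conjugating by the quotients of \<open>quotient_commutant\<close>,
  which are in the commutant.\<close>

lemma commutant_conj:
  assumes x: "x \<in> commutant B" shows "r (- w) ** x ** r w \<in> commutant B"
proof -
  let ?y = "(r (- w) ** R w) ** x ** (R (- w) ** r w)"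
  have "R w ** x = x ** R w" using x B_R by (simp add: commutant_def)
  then have "?y = r (- w) ** (x ** R w) ** R (- w) ** r w" by (simp flip: matrix_mul_assoc)
  also have "\<dots> = r (- w) ** x ** r w"
    by (simp add: R_mult_assoc R_zero flip: matrix_mul_assoc)
  finally have "r (- w) ** x ** r w = ?y" ..
  moreover have "?y \<in> commutant B"
    using commutant_star_subalgebra[OF B] quotient_commutant x
    by (simp add: unital_star_subalgebra_def)
  ultimately show ?thesis by simp
qed

text \<open>Conjugation by \<open>q\<close> is conjugation by the quotient \<open>?x\<close>,
  followed by conjugation by \<open>Q\<close>; the former maps the bimodule onto itself.\<close>

lemma conj_image_eq:
  assumes "bimodule (commutant B) S"
  shows "(\<lambda>s. q ** s ** r (- 1)) ` S = (\<lambda>s. Q ** s ** R (- 1)) ` S"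
proof -
  let ?x = "R (- 1) ** r 1" and ?x' = "r (- 1) ** R 1"
  have "(\<lambda>s. ?x ** s ** ?x') ` S = S"
    by (rule bimodule_conj_image[OF assms quotient_commutant])
      (simp_all add: r_mult R_mult R_mult_assoc R_zero r_zero flip: matrix_mul_assoc)
  moreover have "Q ** (?x ** s ** ?x') ** R (- 1) = q ** s ** r (- 1)" for s
    by (simp add: Q_mult R_mult R_zero r_one flip: matrix_mul_assoc)
  then have "(\<lambda>s. Q ** s ** R (- 1)) ` (\<lambda>s. ?x ** s ** ?x') ` S = (\<lambda>s. q ** s ** r (- 1)) ` S"
    by (simp add: image_image)
  ultimately show ?thesis by simp
qed

lemma mpow_in_bimodule_iff:
  assumes S: "bimodule (commutant B) S"
  shows "r w \<in> S \<longleftrightarrow> R w \<in> S"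
proof -
  have right: "s ** x \<in> S" if "s \<in> S" "x \<in> commutant B" for s x
  proof -
    have "mat 1 ** s ** x \<in> S" using S that commutant_one unfolding bimodule_def by blast
    then show ?thesis by simp
  qed
  have "R w ** (R (- w) ** r w) = r w" "r w ** (r (- w) ** R w) = R w"
    by (simp_all add: R_mult_assoc R_zero r_mult r_zero)
  then show ?thesis using right quotient_commutant by metis
qed

theorem associated_iff_implementing:
  "associated_to_quantum_adjacency B \<Lambda> Q S \<longleftrightarrow>
     self_adjoint_bimodule (commutant B) S \<and> (\<lambda>s. q ** s ** r (- 1)) ` S = S \<and> r (- (1/2)) \<in> S"
  unfolding associated_iff self_adjoint_bimodule_def
  using conj_image_eq mpow_in_bimodule_iff by metis

lemma bimodule_image:
  assumes "self_adjoint_bimodule (commutant B) S \<and> (\<lambda>s. q ** s ** r (- 1)) ` S = S"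
    and w: "w \<in> {1/2, - (1/2)}"
  shows "self_adjoint_bimodule (commutant B) ((\<lambda>s. r w ** s) ` S) \<and>
    (\<lambda>s. q ** s ** r (- 1)) ` (\<lambda>s. r w ** s) ` S = (\<lambda>s. r w ** s) ` S"
  by (intro conjI self_adjoint_bimodule_image[OF q _ _ w commutant_conj] conj_inv_image[OF q])
    (simp_all only: assms(1))

text \<open>The two directions are \<open>bimodule_image\<close> with the powers \<open>1/2\<close>
  and \<open>- (1/2)\<close>, as \<open>S\<close> is recovered from \<open>S\<^sub>0\<close> by the
  inverse power.\<close>

lemma bimodule_image_iff:
  assumes S\<^sub>0: "S\<^sub>0 = (\<lambda>s. r (1/2) ** s) ` S"
  shows "self_adjoint_bimodule (commutant B) S \<and> (\<lambda>s. q ** s ** r (- 1)) ` S = S \<longleftrightarrow>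
     self_adjoint_bimodule (commutant B) S\<^sub>0 \<and> (\<lambda>s. q ** s ** r (- 1)) ` S\<^sub>0 = S\<^sub>0"
proof -
  have S: "(\<lambda>s. r (- (1/2)) ** s) ` S\<^sub>0 = S"
    unfolding S\<^sub>0 image_mpow_mult[OF q] by (simp add: r_zero)
  have "1/2 \<in> {1/2, - (1/2) :: complex}" "- (1/2) \<in> {1/2, - (1/2) :: complex}" by simp_all
  from bimodule_image[OF _ this(1), of S] bimodule_image[OF _ this(2), of S\<^sub>0]
  show ?thesis unfolding S S\<^sub>0[symmetric] by blast
qed

end

theorem theorem5p29:
  fixes B :: "(complex^'n^'n) set"
    and blk :: "'d::finite \<Rightarrow> nat"
    and \<phi> :: "complex^'n^'n \<Rightarrow> complex^'d^'d"
    and \<psi> :: "complex^'n^'n \<Rightarrow> complex"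
    and Q q :: "complex^'n^'n"
    and \<Lambda> :: "complex^'n^'n \<Rightarrow> complex^'m"
  assumes "unital_star_subalgebra B"
    and "block_decomposition B blk \<phi>"
    and "faithful_state B \<psi>"
    and "Q \<in> B" and "positive_op Q" and "invertible Q"
    and "\<forall>a\<in>B. \<psi> a = trace (\<phi> (Q ** a))"
    and "gns_map B \<psi> \<Lambda>"
    and "positive_op q" and "invertible q"
    and "\<forall>a\<in>B. \<forall>t::real. modular Q (of_real t) a = mpow q (\<i> * of_real t) ** a ** mpow q (- (\<i> * of_real t))"
  shows "bij_betw (\<lambda>S. (\<lambda>s. mpow q (1/2) ** s) ` S) {S. cmat.subspace S} {S. cmat.subspace S} \<and>
    (\<forall>S. cmat.subspace S \<longrightarrow>
      (let S\<^sub>0 = (\<lambda>s. mpow q (1/2) ** s) ` S in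
        S = (\<lambda>s. mpow q (- (1/2)) ** s) ` S\<^sub>0 \<and>
        (self_adjoint_bimodule (commutant B) S \<and> (\<lambda>s. q ** s ** matrix_inv q) ` S = S \<longleftrightarrow>
         self_adjoint_bimodule (commutant B) S\<^sub>0 \<and> (\<lambda>s. q ** s ** matrix_inv q) ` S\<^sub>0 = S\<^sub>0) \<and>
        (mpow q (- (1/2)) \<in> S \<longleftrightarrow> mat 1 \<in> S\<^sub>0) \<and>
        (associated_to_quantum_adjacency B \<Lambda> Q S \<longrightarrow>
           self_adjoint_bimodule (commutant B) S\<^sub>0 \<and> mat 1 \<in> S\<^sub>0 \<and>
           (\<lambda>s. q ** s ** matrix_inv q) ` S\<^sub>0 = S\<^sub>0) \<and>
        (self_adjoint_bimodule (commutant B) S\<^sub>0 \<and> mat 1 \<in> S\<^sub>0 \<and>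
           (\<lambda>s. q ** s ** matrix_inv q) ` S\<^sub>0 = S\<^sub>0 \<longrightarrow>
           associated_to_quantum_adjacency B \<Lambda> Q S)))"
proof -
  interpret implementing_operator B \<psi> "\<lambda>a. trace (\<phi> a)" Q \<Lambda> q
  proof
    \<comment> \<open>Multiplicativity of \<open>\<phi>\<close> transfers the trace property of
      matrices to the functional on \<open>B\<close>.\<close>
    show "trace (\<phi> (a ** b)) = trace (\<phi> (b ** a))" if "a \<in> B" "b \<in> B" for a b
      using assms(2) that trace_mul_sym[of "\<phi> a" "\<phi> b"] by (simp add: block_decomposition_def)
  qed (use assms in auto)
  have inverse: "(\<lambda>s. r (- (1/2)) ** s) ` (\<lambda>s. r (1/2) ** s) ` S = S"
    "(\<lambda>s. r (1/2) ** s) ` (\<lambda>s. r (- (1/2)) ** s) ` S = S" for S :: "(complex^'k^'n) set"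
    unfolding image_mpow_mult[OF q] by (simp_all add: r_zero)
  have subspaces: "(\<lambda>S. (\<lambda>s. r w ** s) ` S) ` {S :: (complex^'k^'n) set. cmat.subspace S} \<subseteq> {S. cmat.subspace S}" for w
    by (intro image_subsetI CollectI subspace_image_mult) (erule CollectD)
  have bij: "bij_betw (\<lambda>S. (\<lambda>s. r (1/2) ** s) ` S) {S :: (complex^'k^'n) set. cmat.subspace S} {S. cmat.subspace S}"
  proof (rule bij_betw_byWitness[where f' = "\<lambda>S. (\<lambda>s. r (- (1/2)) ** s) ` S"])
    show "\<forall>S\<in>{S :: (complex^'k^'n) set. cmat.subspace S}. (\<lambda>s. r (- (1/2)) ** s) ` (\<lambda>s. r (1/2) ** s) ` S = S"
      by (rule ballI) (rule inverse)
    show "\<forall>S\<in>{S :: (complex^'k^'n) set. cmat.subspace S}. (\<lambda>s. r (1/2) ** s) ` (\<lambda>s. r (- (1/2)) ** s) ` S = S"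
      by (rule ballI) (rule inverse)
  qed (rule subspaces)+
  have mem: "r (- (1/2)) \<in> S \<longleftrightarrow> mat 1 \<in> (\<lambda>s. r (1/2) ** s) ` S" for S :: "(complex^'n^'n) set"
  proof
    assume "r (- (1/2)) \<in> S"
    then show "mat 1 \<in> (\<lambda>s. r (1/2) ** s) ` S"
      by (rule image_eqI[rotated]) (simp add: r_mult r_zero)
  next
    assume "mat 1 \<in> (\<lambda>s. r (1/2) ** s) ` S"
    then obtain s where s: "s \<in> S" "mat 1 = r (1/2) ** s" by blast
    have "r (- (1/2)) = r (- (1/2)) ** (r (1/2) ** s)" unfolding s(2)[symmetric] by simp
    also have "\<dots> = s" by (simp add: r_mult r_zero)
    finally have "r (- (1/2)) = s" .
    then show "r (- (1/2)) \<in> S" using s(1) by (rule ssubst)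
  qed
  show ?thesis
    unfolding Let_def matrix_inv_mpow[OF q]
  proof (rule conjI[OF bij], rule allI, rule impI, goal_cases)
    case (1 S)
    show ?case
      \<comment> \<open>What remains is propositional: \<open>associated_iff_implementing\<close>
        describes \<open>S\<close>, and the other equivalences carry that description over to
        \<open>S\<^sub>0\<close>.\<close>
      using inverse(1)[of S, symmetric] bimodule_image_iff[OF refl, of S] associated_iff_implementing[of S] mem[of S]
      by argo
  qed
qed

end
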